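(* There are no nontrivial infinitely divisible metric measure spaces; that is, if $\mathcal{X}\in\mathbb{M}$ is infinitely divisible, then $\mathcal{X}=\mathcal{E}$.
   Context: A metric measure space is a triple $\mathcal{X}=(X,r_X,\mu_X)$ where $(X,r_X)$ is a complete separable metric space and $\mu_X$ is a Borel probability measure on $X$ with full support. Two such spaces are equivalent if there is an isometry from one onto the other that maps the first probability measure to the second by push-forward. $\mathbb{M}$ denotes the set of equivalence classes, and a class is not distinguished from its representatives. $\mathcal{E}\in\mathbb{M}$ is the class of one-point spaces (the trivial space). For $\mathcal{Y},\mathcal{Z}\in\mathbb{M}$, $\mathcal{Y}\boxplus\mathcal{Z}:=(Y\times Z,\,r_Y\oplus r_Z,\,\mu_Y\otimes\mu_Z)$ with $(r_Y\oplus r_Z)((y',z'),(y'',z''))=r_Y(y',y'')+r_Z(z',z'')$; $(\mathbb{M},\boxplus)$ is a commutative semigroup with identity $\mathcal{E}$. An element $\mathcal{X}\in\mathbb{M}$ is infinitely divisible if, for each $n\ge2$, there is $\mathcal{X}_n\in\mathbb{M}$ such that $\mathcal{X}=\mathcal{X}_n\boxplus\cdots\boxplus\mathcal{X}_n$ with $n$ identical summands. *)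

theory Defs
  imports "HOL-Probability.Probability"
begin

section \<open>Metric measure spaces\<close>

type_synonym 'a mmspace = "'a metric \<times> 'a measure"

definition mborel :: "'a metric \<Rightarrow> 'a measure" where
  "mborel m = sigma (mspace m) {U. openin (mtopology_of m) U}"

definition mm_space :: "'a mmspace \<Rightarrow> bool" where
  "mm_space X \<longleftrightarrow>
     mcomplete_of (fst X) \<and> separable_space (mtopology_of (fst X)) \<and>
     sets (snd X) = sets (mborel (fst X)) \<and> prob_space (snd X) \<and>
     (\<forall>U. openin (mtopology_of (fst X)) U \<and> U \<noteq> {} \<longrightarrow> emeasure (snd X) U > 0)"

text \<open>
  Below, \<open>f\<close> is automatically measurable (\<open>isometry_measurable\<close>), so that \<open>distr\<close> is indeed the
  push-forward.
\<close>

definition mm_iso :: "'a mmspace \<Rightarrow> 'b mmspace \<Rightarrow> bool" where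
  "mm_iso X Y \<longleftrightarrow> (\<exists>f. f ` mspace (fst X) = mspace (fst Y) \<and>
     (\<forall>x\<in>mspace (fst X). \<forall>x'\<in>mspace (fst X). mdist (fst Y) (f x) (f x') = mdist (fst X) x x') \<and>
     distr (snd X) (snd Y) f = snd Y)"

definition sum_metric :: "'a metric \<Rightarrow> 'b metric \<Rightarrow> ('a \<times> 'b) metric" where
  "sum_metric m1 m2 =
     metric (mspace m1 \<times> mspace m2, \<lambda>(y, z) (y', z'). mdist m1 y y' + mdist m2 z z')"

definition mm_sum :: "'a mmspace \<Rightarrow> 'b mmspace \<Rightarrow> ('a \<times> 'b) mmspace" where
  "mm_sum Y Z = (sum_metric (fst Y) (fst Z), snd Y \<Otimes>\<^sub>M snd Z)"

definition mm_point :: "unit mmspace" where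
  "mm_point = (metric (UNIV, \<lambda>_ _. 0), return (count_space UNIV) ())"

section \<open>Basic facts\<close>

lemma openin_mtopology_of:
  "openin (mtopology_of m) U \<longleftrightarrow>
     U \<subseteq> mspace m \<and> (\<forall>x\<in>U. \<exists>r>0. mball_of m x r \<subseteq> U)"
proof -
  interpret Metric_space "mspace m" "mdist m" by simp
  show ?thesis by (auto simp: mtopology_of_def mball_of_def openin_mtopology)
qed

lemma openin_mball_of: "openin (mtopology_of m) (mball_of m x r)"
  by (simp add: mtopology_of_def mball_of_def Metric_space.openin_mball)

lemma mborel_gen_subset: "{U. openin (mtopology_of m) U} \<subseteq> Pow (mspace m)"
  by (auto simp: openin_mtopology_of)

lemma space_mborel [simp]: "space (mborel m) = mspace m"
  unfolding mborel_def by (rule space_measure_of[OF mborel_gen_subset])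

lemma sets_mborel: "sets (mborel m) = sigma_sets (mspace m) {U. openin (mtopology_of m) U}"
  unfolding mborel_def by (rule sets_measure_of[OF mborel_gen_subset])

lemma open_in_mborel: "openin (mtopology_of m) U \<Longrightarrow> U \<in> sets (mborel m)"
  unfolding sets_mborel by (auto intro: sigma_sets.Basic)

lemma measurable_mborelI:
  assumes "f \<in> space N \<rightarrow> mspace m"
    and "\<And>U. openin (mtopology_of m) U \<Longrightarrow> f -` U \<inter> space N \<in> sets N"
  shows "f \<in> measurable N (mborel m)"
  unfolding mborel_def
  by (rule measurable_measure_of[OF mborel_gen_subset]) (use assms in auto)

lemma Lipschitz_measurable_mborel:
  assumes f: "f \<in> mspace m \<rightarrow> mspace m'"
    and lip: "\<And>x y. x \<in> mspace m \<Longrightarrow> y \<in> mspace m \<Longrightarrow> mdist m' (f x) (f y) \<le> mdist m x y"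
  shows "f \<in> measurable (mborel m) (mborel m')"
proof (rule measurable_mborelI)
  fix U assume U: "openin (mtopology_of m') U"
  have "openin (mtopology_of m) (f -` U \<inter> mspace m)"
    unfolding openin_mtopology_of
  proof (intro conjI ballI)
    fix x assume x: "x \<in> f -` U \<inter> mspace m"
    then obtain r where r: "r > 0" "mball_of m' (f x) r \<subseteq> U"
      using U by (auto simp: openin_mtopology_of)
    have "mball_of m x r \<subseteq> f -` U \<inter> mspace m"
    proof
      fix y assume y: "y \<in> mball_of m x r"
      then have "f y \<in> mball_of m' (f x) r"
        using x f lip[of x y] by (auto simp: Pi_iff)
      then show "y \<in> f -` U \<inter> mspace m" using r y by auto
    qed
    then show "\<exists>r>0. mball_of m x r \<subseteq> f -` U \<inter> mspace m" using r by blast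
  qed auto
  then show "f -` U \<inter> space (mborel m) \<in> sets (mborel m)"
    by (simp add: open_in_mborel)
qed (use f in simp)

lemma separable_space_mtopology_of_iff:
  "separable_space (mtopology_of m) \<longleftrightarrow>
     (\<exists>D. countable D \<and> D \<subseteq> mspace m \<and> (\<forall>x\<in>mspace m. \<forall>r>0. \<exists>y\<in>D. mdist m x y < r))"
proof -
  interpret Metric_space "mspace m" "mdist m" by simp
  have *: "mtopology closure_of D = mspace m \<longleftrightarrow>
      (\<forall>x\<in>mspace m. \<forall>r>0. \<exists>y\<in>D. mdist m x y < r)" if "D \<subseteq> mspace m" for D
  proof -
    have "mtopology closure_of D = mspace m \<longleftrightarrow>
      (\<forall>x\<in>mspace m. \<forall>r>0. \<exists>y\<in>D. y \<in> mball x r)"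
      unfolding metric_closure_of by blast
    with that show ?thesis by (simp add: subset_iff)
  qed
  show ?thesis
    unfolding separable_space_def mtopology_of_def topspace_mtopology using * by metis
qed

lemma mm_space_space: "mm_space X \<Longrightarrow> space (snd X) = mspace (fst X)"
  by (metis mm_space_def sets_eq_imp_space_eq space_mborel)

lemma mm_space_sets: "mm_space X \<Longrightarrow> sets (snd X) = sets (mborel (fst X))"
  by (simp add: mm_space_def)

lemma mm_space_prob: "mm_space X \<Longrightarrow> prob_space (snd X)"
  by (simp add: mm_space_def)

lemma mm_space_support:
  "mm_space X \<Longrightarrow> openin (mtopology_of (fst X)) U \<Longrightarrow> U \<noteq> {} \<Longrightarrow> emeasure (snd X) U > 0"
  unfolding mm_space_def by blast

lemma mm_iso_refl: "mm_iso X X"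
  unfolding mm_iso_def by (rule exI[of _ "\<lambda>x. x"]) (auto simp: distr_id2)

lemma isometry_inj:
  assumes "\<And>x x'. x \<in> mspace m \<Longrightarrow> x' \<in> mspace m \<Longrightarrow> mdist m' (f x) (f x') = mdist m x x'"
    and "f ` mspace m \<subseteq> mspace m'"
  shows "inj_on f (mspace m)"
proof (rule inj_onI)
  fix x y assume *: "x \<in> mspace m" "y \<in> mspace m" "f x = f y"
  have "f y \<in> mspace m'" using * assms by auto
  then have "mdist m' (f x) (f y) = 0" using * by simp
  then show "x = y" using assms(1)[of x y] * by simp
qed

lemma isometry_measurable:
  assumes X: "mm_space X" and Y: "mm_space Y"
    and "f ` mspace (fst X) \<subseteq> mspace (fst Y)"
    and "\<And>x x'. x \<in> mspace (fst X) \<Longrightarrow> x' \<in> mspace (fst X) \<Longrightarrow>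
      mdist (fst Y) (f x) (f x') = mdist (fst X) x x'"
  shows "f \<in> measurable (snd X) (snd Y)"
proof -
  have "f \<in> measurable (mborel (fst X)) (mborel (fst Y))"
    by (rule Lipschitz_measurable_mborel) (use assms in auto)
  then show ?thesis
    using measurable_cong_sets[OF mm_space_sets[OF X] mm_space_sets[OF Y]] by simp
qed

lemma mm_isoD:
  assumes "mm_iso X Y" "mm_space X" "mm_space Y"
  shows "\<exists>f. bij_betw f (mspace (fst X)) (mspace (fst Y)) \<and>
    (\<forall>x\<in>mspace (fst X). \<forall>x'\<in>mspace (fst X). mdist (fst Y) (f x) (f x') = mdist (fst X) x x') \<and>
    f \<in> measurable (snd X) (snd Y) \<and> distr (snd X) (snd Y) f = snd Y"
proof -
  obtain f where f: "f ` mspace (fst X) = mspace (fst Y)"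
     "\<And>x x'. x \<in> mspace (fst X) \<Longrightarrow> x' \<in> mspace (fst X) \<Longrightarrow>
       mdist (fst Y) (f x) (f x') = mdist (fst X) x x'"
     "distr (snd X) (snd Y) f = snd Y"
    using assms unfolding mm_iso_def by blast
  have "bij_betw f (mspace (fst X)) (mspace (fst Y))"
    unfolding bij_betw_def using f isometry_inj[of "fst X" "fst Y" f] by auto
  moreover have "f \<in> measurable (snd X) (snd Y)"
    using isometry_measurable[OF assms(2,3), of f] f by auto
  ultimately show ?thesis using f by blast
qed

lemma mm_iso_sym:
  assumes "mm_iso X Y" "mm_space X" "mm_space Y"
  shows "mm_iso Y X"
proof -
  obtain f where f: "bij_betw f (mspace (fst X)) (mspace (fst Y))"
    "\<And>x x'. x \<in> mspace (fst X) \<Longrightarrow> x' \<in> mspace (fst X) \<Longrightarrow>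
       mdist (fst Y) (f x) (f x') = mdist (fst X) x x'"
    "f \<in> measurable (snd X) (snd Y)" "distr (snd X) (snd Y) f = snd Y"
    using mm_isoD[OF assms] by blast
  define g where "g = inv_into (mspace (fst X)) f"
  have g: "bij_betw g (mspace (fst Y)) (mspace (fst X))"
    unfolding g_def by (rule bij_betw_inv_into[OF f(1)])
  have fg: "f (g y) = y" if "y \<in> mspace (fst Y)" for y
    using that f(1) unfolding g_def by (simp add: bij_betw_inv_into_right)
  have gf: "g (f x) = x" if "x \<in> mspace (fst X)" for x
    using that f(1) unfolding g_def by (simp add: bij_betw_inv_into_left)
  have iso: "mdist (fst X) (g y) (g y') = mdist (fst Y) y y'"
    if "y \<in> mspace (fst Y)" "y' \<in> mspace (fst Y)" for y y'
    using f(2)[of "g y" "g y'"] that bij_betwE[OF g] fg by simp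
  have gm: "g \<in> measurable (snd Y) (snd X)"
    using isometry_measurable[OF assms(3,2), of g] g iso by (auto simp: bij_betw_def)
  have "distr (snd Y) (snd X) g = distr (distr (snd X) (snd Y) f) (snd X) g"
    by (simp add: f(4))
  also have "\<dots> = distr (snd X) (snd X) (g \<circ> f)"
    by (rule distr_distr[OF gm f(3)])
  also have "\<dots> = distr (snd X) (snd X) (\<lambda>x. x)"
    by (rule distr_cong) (auto simp: gf mm_space_space[OF assms(2)])
  finally have "distr (snd Y) (snd X) g = snd X" by (simp add: distr_id2)
  then show ?thesis unfolding mm_iso_def using g iso by (auto simp: bij_betw_def)
qed

lemma mm_iso_trans:
  assumes "mm_iso X Y" "mm_iso Y Z" "mm_space X" "mm_space Y" "mm_space Z"
  shows "mm_iso X Z"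
proof -
  obtain f where f: "bij_betw f (mspace (fst X)) (mspace (fst Y))"
    "\<And>x x'. x \<in> mspace (fst X) \<Longrightarrow> x' \<in> mspace (fst X) \<Longrightarrow>
       mdist (fst Y) (f x) (f x') = mdist (fst X) x x'"
    "f \<in> measurable (snd X) (snd Y)" "distr (snd X) (snd Y) f = snd Y"
    using mm_isoD[OF assms(1,3,4)] by blast
  obtain g where g: "bij_betw g (mspace (fst Y)) (mspace (fst Z))"
    "\<And>x x'. x \<in> mspace (fst Y) \<Longrightarrow> x' \<in> mspace (fst Y) \<Longrightarrow>
       mdist (fst Z) (g x) (g x') = mdist (fst Y) x x'"
    "g \<in> measurable (snd Y) (snd Z)" "distr (snd Y) (snd Z) g = snd Z"
    using mm_isoD[OF assms(2,4,5)] by blast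
  have "distr (snd X) (snd Z) (g \<circ> f) = snd Z"
    using distr_distr[OF g(3) f(3)] f(4) g(4) by simp
  moreover have "(g \<circ> f) ` mspace (fst X) = mspace (fst Z)"
    using f(1) g(1) unfolding bij_betw_def by (metis image_comp)
  moreover have "mdist (fst Z) ((g \<circ> f) x) ((g \<circ> f) x') = mdist (fst X) x x'"
    if "x \<in> mspace (fst X)" "x' \<in> mspace (fst X)" for x x'
    using that f(2) g(2) bij_betwE[OF f(1)] by simp
  ultimately show ?thesis unfolding mm_iso_def by blast
qed

section \<open>Every metric measure space has an isomorphic copy on a set of reals\<close>

lemma mm_space_transport:
  fixes X :: "'a mmspace" and g :: "'a \<Rightarrow> 'b"
  assumes X: "mm_space X" and g: "inj_on g (mspace (fst X))"
  shows "\<exists>R :: 'b mmspace. mm_space R \<and> mm_iso R X"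
proof -
  define m where "m = fst X"
  define h where "h = inv_into (mspace m) g"
  define d where "d = (\<lambda>u v. mdist m (h u) (h v))"
  define S where "S = g ` mspace m"
  have hg: "h (g x) = x" if "x \<in> mspace m" for x
    using that g by (simp add: h_def m_def)
  have gh: "g (h u) = u" and hm: "h u \<in> mspace m" if "u \<in> S" for u
    using that by (auto simp: h_def S_def f_inv_into_f inv_into_into)
  interpret S: Metric_space S d
  proof
    show "0 \<le> d x y" "d x y = d y x" for x y by (auto simp: d_def mdist_commute)
    show "d x y = 0 \<longleftrightarrow> x = y" if "x \<in> S" "y \<in> S" for x y
      using that hm gh by (metis d_def mdist_zero)
    show "d x z \<le> d x y + d y z" if "x \<in> S" "y \<in> S" "z \<in> S" for x y z
      unfolding d_def using that hm by (simp add: mdist_triangle)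
  qed
  interpret M: Metric_space "mspace m" "mdist m" by simp
  define k where "k = metric (S, d)"
  have k [simp]: "mspace k = S" "mdist k = d" by (simp_all add: k_def)
  have dg: "d (g x) (g y) = mdist m x y" if "x \<in> mspace m" "y \<in> mspace m" for x y
    using that by (simp add: d_def hg)
  have gmeas: "g \<in> measurable (mborel m) (mborel k)"
    by (rule Lipschitz_measurable_mborel) (auto simp: dg S_def)
  have hmeas: "h \<in> measurable (mborel k) (mborel m)"
    by (rule Lipschitz_measurable_mborel) (auto simp: hm d_def)
  have gX: "g \<in> measurable (snd X) (mborel k)"
    using gmeas measurable_cong_sets[OF mm_space_sets[OF X] refl] m_def by blast
  define R where "R = (k, distr (snd X) (mborel k) g)"
  have comp: "mcomplete_of k"
  proof -
    have Mc: "M.mcomplete" using X by (simp add: mm_space_def mcomplete_of_def m_def)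
    have "S.mcomplete"
      unfolding S.mcomplete_def
    proof (intro allI impI)
      fix \<sigma> assume c: "S.MCauchy \<sigma>"
      then have r: "range \<sigma> \<subseteq> S" by (simp add: S.MCauchy_def)
      have "M.MCauchy (h \<circ> \<sigma>)"
        using c hm unfolding S.MCauchy_def M.MCauchy_def by (auto simp: d_def)
      then obtain x where "limitin M.mtopology (h \<circ> \<sigma>) x sequentially"
        using Mc by (auto simp: M.mcomplete_def)
      then have x: "x \<in> mspace m"
        and lim: "\<And>\<epsilon>. \<epsilon> > 0 \<Longrightarrow> \<forall>\<^sub>F n in sequentially. mdist m (h (\<sigma> n)) x < \<epsilon>"
        by (auto simp: M.limitin_metric elim: eventually_mono)
      have "limitin S.mtopology \<sigma> (g x) sequentially"
        unfolding S.limitin_metric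
      proof (intro conjI allI impI)
        show "g x \<in> S" using x by (simp add: S_def)
        fix \<epsilon> :: real assume "\<epsilon> > 0"
        from lim[OF this] show "\<forall>\<^sub>F n in sequentially. \<sigma> n \<in> S \<and> d (\<sigma> n) (g x) < \<epsilon>"
          by (rule eventually_mono) (use r x in \<open>auto simp: d_def hg\<close>)
      qed
      then show "\<exists>x. limitin S.mtopology \<sigma> x sequentially" by blast
    qed
    then show ?thesis by (simp add: k_def)
  qed
  have sep: "separable_space (mtopology_of k)"
  proof -
    have "separable_space (mtopology_of m)" using X by (simp add: mm_space_def m_def)
    then obtain D where D: "countable D" "D \<subseteq> mspace m"
      "\<And>x r. x \<in> mspace m \<Longrightarrow> r > 0 \<Longrightarrow> \<exists>y\<in>D. mdist m x y < r"
      unfolding separable_space_mtopology_of_iff by blast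
    have "\<exists>y\<in>g ` D. d u y < r" if "u \<in> S" "r > 0" for u r
      using D(3)[OF hm[OF that(1)] that(2)] D(2) by (auto simp: d_def hg subset_iff)
    then show ?thesis unfolding separable_space_mtopology_of_iff
      using D(1,2) by (intro exI[of _ "g ` D"]) (auto simp: S_def)
  qed
  have supp: "emeasure (distr (snd X) (mborel k) g) U > 0"
    if U: "openin (mtopology_of k) U" "U \<noteq> {}" for U
  proof -
    have "openin (mtopology_of m) (g -` U \<inter> mspace m)"
      unfolding openin_mtopology_of
    proof (intro conjI ballI)
      fix x assume x: "x \<in> g -` U \<inter> mspace m"
      then obtain r where r: "r > 0" "mball_of k (g x) r \<subseteq> U"
        using U unfolding openin_mtopology_of by blast
      have "mball_of m x r \<subseteq> g -` U \<inter> mspace m"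
        using x r(2) by (auto simp: S_def dg subset_iff)
      then show "\<exists>r>0. mball_of m x r \<subseteq> g -` U \<inter> mspace m" using r by blast
    qed auto
    moreover have "g -` U \<inter> mspace m \<noteq> {}"
      using U unfolding openin_mtopology_of k S_def by blast
    ultimately have "emeasure (snd X) (g -` U \<inter> mspace m) > 0"
      using X unfolding mm_space_def m_def by blast
    then show ?thesis
      by (simp add: emeasure_distr[OF gX open_in_mborel[OF U(1)]] mm_space_space[OF X] m_def)
  qed
  have "prob_space (distr (snd X) (mborel k) g)"
    by (rule prob_space.prob_space_distr[OF mm_space_prob[OF X] gX])
  then have R: "mm_space R"
    using comp sep supp by (simp add: mm_space_def R_def)
  have hX: "h \<in> measurable (mborel k) (snd X)"
    using hmeas measurable_cong_sets[OF refl mm_space_sets[OF X]] m_def by blast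
  have "distr (distr (snd X) (mborel k) g) (snd X) h = distr (snd X) (snd X) (h \<circ> g)"
    by (rule distr_distr[OF hX gX])
  also have "\<dots> = distr (snd X) (snd X) (\<lambda>x. x)"
    by (rule distr_cong) (auto simp: hg mm_space_space[OF X] m_def)
  finally have "distr (snd R) (snd X) h = snd X" by (simp add: distr_id2 R_def)
  moreover have "h ` S = mspace m" using hg by (force simp: S_def)
  ultimately have "mm_iso R X"
    unfolding mm_iso_def by (intro exI[of _ h]) (auto simp: R_def d_def m_def)
  with R show ?thesis by blast
qed

lemma separable_inj_real:
  fixes m :: "'a metric"
  assumes "separable_space (mtopology_of m)"
  shows "\<exists>g :: 'a \<Rightarrow> real. inj_on g (mspace m)"
proof -
  obtain D where D: "countable D" "D \<subseteq> mspace m"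
    "\<And>x r. x \<in> mspace m \<Longrightarrow> r > 0 \<Longrightarrow> \<exists>y\<in>D. mdist m x y < r"
    using assms unfolding separable_space_mtopology_of_iff by blast
  define c where "c = (\<lambda>x. {p. mdist m x (from_nat_into D (fst (prod_decode p)))
      < 1 / real (Suc (snd (prod_decode p)))})"
  have "inj_on c (mspace m)"
  proof (rule inj_onI, rule ccontr)
    fix x y assume x: "x \<in> mspace m" and y: "y \<in> mspace m" and eq: "c x = c y" and "x \<noteq> y"
    then have "mdist m x y > 0" by (metis mdist_nonneg mdist_zero order_le_less)
    then obtain n where n: "1 / real (Suc n) < mdist m x y / 2"
      using reals_Archimedean[of "mdist m x y / 2"] by (auto simp: inverse_eq_divide)
    obtain z where z: "z \<in> D" "mdist m x z < 1 / real (Suc n)"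
      using D(3)[OF x, of "1 / real (Suc n)"] by auto
    then obtain i where i: "from_nat_into D i = z"
      using from_nat_into_surj[OF D(1)] by blast
    have "prod_encode (i, n) \<in> c x" using z i by (simp add: c_def)
    then have "mdist m y z < 1 / real (Suc n)" using i unfolding eq by (simp add: c_def)
    moreover have "mdist m x y \<le> mdist m x z + mdist m z y"
      using x y z D(2) by (intro mdist_triangle) auto
    ultimately show False using n z(2) mdist_commute[of m y z] by linarith
  qed
  moreover obtain e :: "nat set \<Rightarrow> real" where "inj e"
    using nat_sets_eqpoll_reals by (auto simp: eqpoll_def bij_betw_def)
  ultimately have "inj_on (e \<circ> c) (mspace m)"
    by (metis comp_inj_on inj_on_subset subset_UNIV)
  then show ?thesis by blast
qed

lemma ex_real_copy:
  fixes X :: "'a mmspace"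
  assumes "mm_space X"
  shows "\<exists>R :: real mmspace. mm_space R \<and> mm_iso R X"
proof -
  have "separable_space (mtopology_of (fst X))" using assms by (simp add: mm_space_def)
  then obtain g :: "'a \<Rightarrow> real" where "inj_on g (mspace (fst X))"
    using separable_inj_real by blast
  then show ?thesis by (rule mm_space_transport[OF assms])
qed

section \<open>The sum of two metric measure spaces\<close>

lemma Metric_space_sum:
  "Metric_space (mspace m1 \<times> mspace m2) (\<lambda>(y, z) (y', z'). mdist m1 y y' + mdist m2 z z')"
  (is "Metric_space ?M ?d")
proof
  have d: "?d p q = mdist m1 (fst p) (fst q) + mdist m2 (snd p) (snd q)" for p q
    by (simp add: case_prod_beta)
  show "0 \<le> ?d p q" for p q unfolding d by simp
  show "?d p q = ?d q p" for p q unfolding d by (simp add: mdist_commute)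
  fix p q r assume pq: "p \<in> ?M" "q \<in> ?M"
  have "?d p q = 0 \<longleftrightarrow> mdist m1 (fst p) (fst q) = 0 \<and> mdist m2 (snd p) (snd q) = 0"
    unfolding d by (rule add_nonneg_eq_0_iff) simp_all
  also have "\<dots> \<longleftrightarrow> p = q"
    using pq by (auto simp: mem_Times_iff prod_eq_iff)
  finally show "?d p q = 0 \<longleftrightarrow> p = q" .
  assume r: "r \<in> ?M"
  have "mdist m1 (fst p) (fst r) \<le> mdist m1 (fst p) (fst q) + mdist m1 (fst q) (fst r)"
    "mdist m2 (snd p) (snd r) \<le> mdist m2 (snd p) (snd q) + mdist m2 (snd q) (snd r)"
    using pq r by (auto simp: mem_Times_iff intro: mdist_triangle)
  then show "?d p r \<le> ?d p q + ?d q r" unfolding d by linarith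
qed

lemma mspace_sum_metric [simp]: "mspace (sum_metric m1 m2) = mspace m1 \<times> mspace m2"
  unfolding sum_metric_def by (rule Metric_space.mspace_metric[OF Metric_space_sum])

lemma mdist_sum_metric [simp]:
  "mdist (sum_metric m1 m2) p q = mdist m1 (fst p) (fst q) + mdist m2 (snd p) (snd q)"
  unfolding sum_metric_def Metric_space.mdist_metric[OF Metric_space_sum]
  by (simp split: prod.splits)

lemma mcomplete_sum_metric:
  assumes "mcomplete_of m1" "mcomplete_of m2"
  shows "mcomplete_of (sum_metric m1 m2)"
proof -
  interpret M1: Metric_space "mspace m1" "mdist m1" by simp
  interpret M2: Metric_space "mspace m2" "mdist m2" by simp
  interpret M: Metric_space "mspace m1 \<times> mspace m2" "mdist (sum_metric m1 m2)"
    by (metis Metric_space_mspace_mdist mspace_sum_metric)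
  have le: "mdist m1 (fst p) (fst q) \<le> mdist (sum_metric m1 m2) p q"
    "mdist m2 (snd p) (snd q) \<le> mdist (sum_metric m1 m2) p q" for p q by simp_all
  have "M.mcomplete"
    unfolding M.mcomplete_def
  proof (intro allI impI)
    fix \<sigma> assume c: "M.MCauchy \<sigma>"
    then have r: "\<sigma> n \<in> mspace m1 \<times> mspace m2" for n by (auto simp: M.MCauchy_def)
    have r': "range (fst \<circ> \<sigma>) \<subseteq> mspace m1" "range (snd \<circ> \<sigma>) \<subseteq> mspace m2"
      using r by (auto simp: mem_Times_iff)
    have "M1.MCauchy (fst \<circ> \<sigma>)" "M2.MCauchy (snd \<circ> \<sigma>)"
      using c r' le unfolding M.MCauchy_def M1.MCauchy_def M2.MCauchy_def o_def
      by (meson order_le_less_trans)+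
    then obtain x y where "limitin M1.mtopology (fst \<circ> \<sigma>) x sequentially"
       "limitin M2.mtopology (snd \<circ> \<sigma>) y sequentially"
      using assms unfolding mcomplete_of_def M1.mcomplete_def M2.mcomplete_def by blast
    then have x: "x \<in> mspace m1" "y \<in> mspace m2"
      and lim: "\<And>\<epsilon>. \<epsilon> > 0 \<Longrightarrow> \<forall>\<^sub>F n in sequentially. mdist m1 (fst (\<sigma> n)) x < \<epsilon>"
       "\<And>\<epsilon>. \<epsilon> > 0 \<Longrightarrow> \<forall>\<^sub>F n in sequentially. mdist m2 (snd (\<sigma> n)) y < \<epsilon>"
      by (auto simp: M1.limitin_metric M2.limitin_metric elim: eventually_mono)
    have "limitin M.mtopology \<sigma> (x, y) sequentially"
      unfolding M.limitin_metric
    proof (intro conjI allI impI)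
      show "(x, y) \<in> mspace m1 \<times> mspace m2" using x by simp
      fix \<epsilon> :: real assume "\<epsilon> > 0"
      then have "\<epsilon> / 2 > 0" by simp
      from lim(1)[OF this] lim(2)[OF this]
      show "\<forall>\<^sub>F n in sequentially. \<sigma> n \<in> mspace m1 \<times> mspace m2 \<and>
          mdist (sum_metric m1 m2) (\<sigma> n) (x, y) < \<epsilon>"
        by eventually_elim (use r in auto)
    qed
    then show "\<exists>x. limitin M.mtopology \<sigma> x sequentially" by blast
  qed
  then show ?thesis by (simp add: mcomplete_of_def)
qed

lemma separable_sum_metric:
  assumes "separable_space (mtopology_of m1)" "separable_space (mtopology_of m2)"
  shows "separable_space (mtopology_of (sum_metric m1 m2))"
proof -
  obtain D where D: "countable D" "D \<subseteq> mspace m1"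
    "\<And>x r. x \<in> mspace m1 \<Longrightarrow> r > 0 \<Longrightarrow> \<exists>y\<in>D. mdist m1 x y < r"
    using assms(1) unfolding separable_space_mtopology_of_iff by blast
  obtain E where E: "countable E" "E \<subseteq> mspace m2"
    "\<And>x r. x \<in> mspace m2 \<Longrightarrow> r > 0 \<Longrightarrow> \<exists>y\<in>E. mdist m2 x y < r"
    using assms(2) unfolding separable_space_mtopology_of_iff by blast
  have "\<exists>q\<in>D \<times> E. mdist (sum_metric m1 m2) p q < r"
    if p: "p \<in> mspace m1 \<times> mspace m2" and "r > 0" for p r
  proof -
    have "r / 2 > 0" using that by simp
    then obtain y z where "y \<in> D" "mdist m1 (fst p) y < r / 2" "z \<in> E" "mdist m2 (snd p) z < r / 2"
      using D(3)[of "fst p" "r / 2"] E(3)[of "snd p" "r / 2"] p by (auto simp: mem_Times_iff)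
    then show ?thesis by (intro bexI[of _ "(y, z)"]) auto
  qed
  then show ?thesis unfolding separable_space_mtopology_of_iff
    using D(1,2) E(1,2) by (intro exI[of _ "D \<times> E"]) auto
qed

lemma openin_sum_metric_box:
  assumes "openin (mtopology_of (sum_metric m1 m2)) U" "(x, y) \<in> U"
  shows "\<exists>r>0. mball_of m1 x r \<times> mball_of m2 y r \<subseteq> U"
proof -
  obtain r where r: "r > 0" "mball_of (sum_metric m1 m2) (x, y) r \<subseteq> U"
    using assms by (auto simp: openin_mtopology_of)
  have "mball_of m1 x (r / 2) \<times> mball_of m2 y (r / 2) \<subseteq> mball_of (sum_metric m1 m2) (x, y) r"
    by auto
  with r show ?thesis by (intro exI[of _ "r / 2"]) auto
qed

lemma sets_mborel_sum_metric:
  assumes "separable_space (mtopology_of m1)" "separable_space (mtopology_of m2)"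
  shows "sets (mborel (sum_metric m1 m2)) = sets (mborel m1 \<Otimes>\<^sub>M mborel m2)"
proof
  let ?P = "mborel m1 \<Otimes>\<^sub>M mborel m2"
  obtain D where D: "countable D" "D \<subseteq> mspace m1"
    "\<And>x r. x \<in> mspace m1 \<Longrightarrow> r > 0 \<Longrightarrow> \<exists>y\<in>D. mdist m1 x y < r"
    using assms(1) unfolding separable_space_mtopology_of_iff by blast
  obtain E where E: "countable E" "E \<subseteq> mspace m2"
    "\<And>x r. x \<in> mspace m2 \<Longrightarrow> r > 0 \<Longrightarrow> \<exists>y\<in>E. mdist m2 x y < r"
    using assms(2) unfolding separable_space_mtopology_of_iff by blast
  have op: "U \<in> sets ?P" if U: "openin (mtopology_of (sum_metric m1 m2)) U" for U
  proof -
    define B where "B = (\<lambda>(y, z, q). mball_of m1 y (real_of_rat q) \<times> mball_of m2 z (real_of_rat q))"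
    define I where "I = {t \<in> D \<times> E \<times> UNIV. B t \<subseteq> U}"
    have "U \<subseteq> (\<Union>t\<in>I. B t)"
    proof
      fix p assume p: "p \<in> U"
      obtain x w where xw: "p = (x, w)" by (cases p)
      have m: "x \<in> mspace m1" "w \<in> mspace m2"
        using U p xw by (auto simp: openin_mtopology_of)
      obtain r where r: "r > 0" "mball_of m1 x r \<times> mball_of m2 w r \<subseteq> U"
        using openin_sum_metric_box[OF U] p xw by blast
      obtain q where q: "0 < real_of_rat q" "real_of_rat q < r / 2"
        using of_rat_dense[of 0 "r / 2"] r by auto
      obtain y z where yz: "y \<in> D" "mdist m1 x y < real_of_rat q" "z \<in> E" "mdist m2 w z < real_of_rat q"
        using D(3)[OF m(1) q(1)] E(3)[OF m(2) q(1)] by blast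
      have yz': "y \<in> mspace m1" "z \<in> mspace m2" using yz D E by auto
      have "B (y, z, q) \<subseteq> mball_of m1 x r \<times> mball_of m2 w r"
      proof
        fix s assume "s \<in> B (y, z, q)"
        then obtain a b where s: "s = (a, b)" "a \<in> mspace m1" "b \<in> mspace m2"
          "mdist m1 y a < real_of_rat q" "mdist m2 z b < real_of_rat q"
          by (auto simp: B_def)
        have "mdist m1 x a \<le> mdist m1 x y + mdist m1 y a" "mdist m2 w b \<le> mdist m2 w z + mdist m2 z b"
          using s m yz' by (auto intro: mdist_triangle)
        then have "mdist m1 x a < r" "mdist m2 w b < r" using s yz q by linarith+
        then show "s \<in> mball_of m1 x r \<times> mball_of m2 w r" using s m by simp
      qed
      then have "(y, z, q) \<in> I" using yz r by (auto simp: I_def)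
      moreover have "p \<in> B (y, z, q)"
        using xw m yz yz' by (auto simp: B_def mdist_commute)
      ultimately show "p \<in> (\<Union>t\<in>I. B t)" by blast
    qed
    then have "U = (\<Union>t\<in>I. B t)" by (auto simp: I_def)
    moreover have "countable I"
    proof (rule countable_subset)
      show "I \<subseteq> D \<times> E \<times> UNIV" unfolding I_def by blast
      show "countable (D \<times> E \<times> (UNIV :: rat set))" by (intro countable_SIGMA D E) simp
    qed
    moreover have "B t \<in> sets ?P" for t
      by (auto simp: B_def split: prod.splits intro!: pair_measureI open_in_mborel openin_mball_of)
    ultimately show ?thesis by (metis (no_types, lifting) sets.countable_UN'' )
  qed
  have "{U. openin (mtopology_of (sum_metric m1 m2)) U} \<subseteq> sets ?P" using op by auto
  then show "sets (mborel (sum_metric m1 m2)) \<subseteq> sets ?P"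
    unfolding sets_mborel using sets.sigma_sets_subset[of _ ?P]
    by (simp add: space_pair_measure)
next
  let ?Q = "mborel (sum_metric m1 m2)"
  have m: "fst \<in> measurable ?Q (mborel m1)" "snd \<in> measurable ?Q (mborel m2)"
    by (auto intro!: Lipschitz_measurable_mborel)
  have "a \<times> b \<in> sets ?Q" if "a \<in> sets (mborel m1)" "b \<in> sets (mborel m2)" for a b
  proof -
    have "a \<subseteq> mspace m1" "b \<subseteq> mspace m2"
      using that[THEN sets.sets_into_space] by auto
    then have "a \<times> b = (fst -` a \<inter> space ?Q) \<inter> (snd -` b \<inter> space ?Q)" by auto
    then show ?thesis using m that by (metis measurable_sets sets.Int)
  qed
  then have "{a \<times> b |a b. a \<in> sets (mborel m1) \<and> b \<in> sets (mborel m2)} \<subseteq> sets ?Q" by auto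
  then show "sets (mborel m1 \<Otimes>\<^sub>M mborel m2) \<subseteq> sets ?Q"
    unfolding sets_pair_measure using sets.sigma_sets_subset[of _ ?Q] by simp
qed

lemma mm_space_sum:
  assumes Y: "mm_space Y" and Z: "mm_space Z"
  shows "mm_space (mm_sum Y Z)"
proof -
  interpret PY: prob_space "snd Y" by (rule mm_space_prob[OF Y])
  interpret PZ: prob_space "snd Z" by (rule mm_space_prob[OF Z])
  interpret P: pair_prob_space "snd Y" "snd Z" ..
  have supp: "emeasure (snd Y \<Otimes>\<^sub>M snd Z) U > 0"
    if U: "openin (mtopology_of (sum_metric (fst Y) (fst Z))) U" "U \<noteq> {}" for U
  proof -
    obtain x y where xy: "(x, y) \<in> U" using U by auto
    then obtain r where r: "r > 0" "mball_of (fst Y) x r \<times> mball_of (fst Z) y r \<subseteq> U"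
      using openin_sum_metric_box[OF U(1)] by blast
    have m: "x \<in> mspace (fst Y)" "y \<in> mspace (fst Z)"
      using U xy by (auto simp: openin_mtopology_of)
    let ?A = "mball_of (fst Y) x r" and ?B = "mball_of (fst Z) y r"
    have "mdist (fst Y) x x = 0" "mdist (fst Z) y y = 0" using m by simp_all
    then have "x \<in> ?A" "y \<in> ?B" using m r(1) by (simp_all only: in_mball_of)
    then have pos: "emeasure (snd Y) ?A > 0" "emeasure (snd Z) ?B > 0"
      using mm_space_support[OF Y openin_mball_of] mm_space_support[OF Z openin_mball_of] by blast+
    have "?A \<in> sets (snd Y)" "?B \<in> sets (snd Z)"
      using Y Z by (auto simp: mm_space_sets intro!: open_in_mborel openin_mball_of)
    then have "emeasure (snd Y \<Otimes>\<^sub>M snd Z) (?A \<times> ?B) = emeasure (snd Y) ?A * emeasure (snd Z) ?B"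
      by (rule PZ.emeasure_pair_measure_Times)
    also have "\<dots> > 0" using pos by (simp add: ennreal_zero_less_mult_iff)
    finally have "0 < emeasure (snd Y \<Otimes>\<^sub>M snd Z) (?A \<times> ?B)" .
    also have "\<dots> \<le> emeasure (snd Y \<Otimes>\<^sub>M snd Z) U"
    proof (rule emeasure_mono[OF r(2)])
      have "U \<in> sets (mborel (sum_metric (fst Y) (fst Z)))" by (rule open_in_mborel[OF U(1)])
      also have "\<dots> = sets (snd Y \<Otimes>\<^sub>M snd Z)"
        using Y Z sets_mborel_sum_metric[of "fst Y" "fst Z"]
          sets_pair_measure_cong[OF mm_space_sets[OF Y] mm_space_sets[OF Z]]
        by (simp add: mm_space_def)
      finally show "U \<in> sets (snd Y \<Otimes>\<^sub>M snd Z)" .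
    qed
    finally show ?thesis .
  qed
  have "sets (snd Y \<Otimes>\<^sub>M snd Z) = sets (mborel (sum_metric (fst Y) (fst Z)))"
    using Y Z sets_mborel_sum_metric[of "fst Y" "fst Z"]
      sets_pair_measure_cong[OF mm_space_sets[OF Y] mm_space_sets[OF Z]]
    by (simp add: mm_space_def)
  moreover have "prob_space (snd Y \<Otimes>\<^sub>M snd Z)" by (rule P.prob_space_axioms)
  moreover have "mcomplete_of (sum_metric (fst Y) (fst Z))"
    using Y Z by (intro mcomplete_sum_metric) (simp_all add: mm_space_def)
  moreover have "separable_space (mtopology_of (sum_metric (fst Y) (fst Z)))"
    using Y Z by (intro separable_sum_metric) (simp_all add: mm_space_def)
  ultimately show ?thesis
    using supp unfolding mm_space_def mm_sum_def by simp
qed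

lemma mm_sum_cong:
  assumes "mm_iso Y Y'" "mm_iso Z Z'" "mm_space Y" "mm_space Y'" "mm_space Z" "mm_space Z'"
  shows "mm_iso (mm_sum Y Z) (mm_sum Y' Z')"
proof -
  obtain f where f: "bij_betw f (mspace (fst Y)) (mspace (fst Y'))"
    "\<And>x x'. x \<in> mspace (fst Y) \<Longrightarrow> x' \<in> mspace (fst Y) \<Longrightarrow>
       mdist (fst Y') (f x) (f x') = mdist (fst Y) x x'"
    "f \<in> measurable (snd Y) (snd Y')" "distr (snd Y) (snd Y') f = snd Y'"
    using mm_isoD[OF assms(1,3,4)] by blast
  obtain g where g: "bij_betw g (mspace (fst Z)) (mspace (fst Z'))"
    "\<And>x x'. x \<in> mspace (fst Z) \<Longrightarrow> x' \<in> mspace (fst Z) \<Longrightarrow>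
       mdist (fst Z') (g x) (g x') = mdist (fst Z) x x'"
    "g \<in> measurable (snd Z) (snd Z')" "distr (snd Z) (snd Z') g = snd Z'"
    using mm_isoD[OF assms(2,5,6)] by blast
  interpret PZ': prob_space "distr (snd Z) (snd Z') g"
    using mm_space_prob[OF assms(6)] g(4) by simp
  have "distr (snd Y) (snd Y') f \<Otimes>\<^sub>M distr (snd Z) (snd Z') g
    = distr (snd Y \<Otimes>\<^sub>M snd Z) (snd Y' \<Otimes>\<^sub>M snd Z') (\<lambda>(x, y). (f x, g y))"
    by (rule pair_measure_distr[OF f(3) g(3)]) unfold_locales
  then have "distr (snd Y \<Otimes>\<^sub>M snd Z) (snd Y' \<Otimes>\<^sub>M snd Z') (map_prod f g) = snd Y' \<Otimes>\<^sub>M snd Z'"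
    by (simp add: f(4) g(4) map_prod_def)
  moreover have "map_prod f g ` (mspace (fst Y) \<times> mspace (fst Z)) = mspace (fst Y') \<times> mspace (fst Z')"
    using f(1) g(1) by (simp add: bij_betw_def map_prod_surj_on)
  ultimately show ?thesis
    unfolding mm_iso_def mm_sum_def
    by (intro exI[of _ "map_prod f g"]) (auto simp: f(2) g(2))
qed

section \<open>Isomorphism classes\<close>

lemma Metric_space_unit: "Metric_space (UNIV :: unit set) (\<lambda>_ _. 0)"
  by unfold_locales auto

lemma mm_space_point: "mm_space mm_point"
proof -
  note M = Metric_space_unit
  let ?m = "metric (UNIV :: unit set, \<lambda>_ _. 0)"
  have m: "mspace ?m = UNIV" "mdist ?m = (\<lambda>_ _. 0)"
    by (rule Metric_space.mspace_metric[OF M], rule Metric_space.mdist_metric[OF M])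
  have comp: "mcomplete_of ?m"
    unfolding Metric_space.mcomplete_of[OF M] Metric_space.mcomplete_def[OF M]
  proof (intro allI impI exI)
    fix \<sigma> :: "nat \<Rightarrow> unit"
    show "limitin (Metric_space.mtopology UNIV (\<lambda>_ _. 0)) \<sigma> () sequentially"
      unfolding Metric_space.limitin_metric[OF M] by simp
  qed
  have sep: "separable_space (mtopology_of ?m)"
    unfolding separable_space_mtopology_of_iff m by (rule exI[of _ UNIV]) simp
  have "U \<in> sets (mborel ?m)" for U
  proof (rule open_in_mborel)
    have "U = {} \<or> U = UNIV" by (cases "() \<in> U") auto
    moreover have "\<exists>r::real. r > 0" by (rule exI[of _ 1]) simp
    ultimately show "openin (mtopology_of ?m) U"
      unfolding openin_mtopology_of m by auto
  qed
  then have sets: "sets (mborel ?m) = UNIV" by blast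
  have "emeasure (return (count_space UNIV) ()) U > 0" if "U \<noteq> {}" for U
  proof -
    have "() \<in> U" using that by auto
    then show ?thesis by simp
  qed
  then show ?thesis
    unfolding mm_space_def mm_point_def fst_conv snd_conv
    using comp sep sets by (auto intro!: prob_space_return)
qed

text \<open>
  A separable metric space has at most the cardinality of the continuum, so that every metric
  measure space, on whatever type, is isomorphic to one with carrier a set of reals
  (\<open>ex_real_copy\<close>). An isomorphism class is therefore represented by the set of its members of type
  \<^typ>\<open>real mmspace\<close>, and no class is lost by doing so.
\<close>

definition mm_class :: "'a mmspace \<Rightarrow> real mmspace set" where
  "mm_class X = {R. mm_space R \<and> mm_iso R X}"

typedef MM = "{mm_class X | X :: real mmspace. mm_space X}"
  morphisms members Abs_MM
  using ex_real_copy[OF mm_space_point] by blast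

definition class_of :: "'a mmspace \<Rightarrow> MM" where
  "class_of X = Abs_MM (mm_class X)"

definition representative :: "MM \<Rightarrow> real mmspace" where
  "representative \<X> = (SOME R. R \<in> members \<X>)"

definition MM_add :: "MM \<Rightarrow> MM \<Rightarrow> MM"  (infixl "\<boxplus>" 65) where
  "\<Y> \<boxplus> \<Z> = class_of (mm_sum (representative \<Y>) (representative \<Z>))"

definition trivial_MM :: MM  ("\<E>") where
  "\<E> = class_of mm_point"

lemma mm_class_eq_iff:
  fixes X :: "'a mmspace" and Y :: "'b mmspace"
  assumes X: "mm_space X" and Y: "mm_space Y"
  shows "mm_class X = mm_class Y \<longleftrightarrow> mm_iso X Y"
proof
  assume eq: "mm_class X = mm_class Y"
  obtain R :: "real mmspace" where R: "mm_space R" "mm_iso R X"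
    using ex_real_copy[OF X] by blast
  then have "R \<in> mm_class Y" using eq by (auto simp: mm_class_def)
  then have "mm_iso R Y" by (simp add: mm_class_def)
  then show "mm_iso X Y"
    using mm_iso_trans[OF mm_iso_sym[OF R(2,1) X] _ X R(1) Y] by blast
next
  assume iso: "mm_iso X Y"
  then show "mm_class X = mm_class Y"
    using mm_iso_trans[OF _ iso _ X Y] mm_iso_trans[OF _ mm_iso_sym[OF iso X Y] _ Y X]
    by (auto simp: mm_class_def)
qed

lemma members_class_of:
  fixes X :: "'a mmspace"
  assumes X: "mm_space X"
  shows "members (class_of X) = {R. mm_space R \<and> mm_iso R X}"
proof -
  obtain R :: "real mmspace" where R: "mm_space R" "mm_iso R X"
    using ex_real_copy[OF X] by blast
  then have "mm_class X = mm_class R" using mm_class_eq_iff[OF R(1) X] by simp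
  then have "mm_class X \<in> {mm_class X | X :: real mmspace. mm_space X}" using R by blast
  then show ?thesis by (simp add: class_of_def Abs_MM_inverse mm_class_def)
qed

theorem class_of_eq_iff:
  fixes X :: "'a mmspace" and Y :: "'b mmspace"
  assumes "mm_space X" and "mm_space Y"
  shows "class_of X = class_of Y \<longleftrightarrow> mm_iso X Y"
proof -
  have "class_of X = class_of Y \<longleftrightarrow> members (class_of X) = members (class_of Y)"
    by (simp add: members_inject)
  also have "\<dots> \<longleftrightarrow> mm_class X = mm_class Y"
    by (simp add: members_class_of assms mm_class_def)
  finally show ?thesis by (simp add: mm_class_eq_iff assms)
qed

lemma representative:
  "mm_space (representative \<X>)" "class_of (representative \<X>) = \<X>"
proof -
  obtain X :: "real mmspace" where X: "mm_space X" "members \<X> = mm_class X"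
    using members[of \<X>] by blast
  then have "X \<in> members \<X>" by (simp add: mm_class_def mm_iso_refl)
  then have "representative \<X> \<in> mm_class X"
    unfolding representative_def X(2)[symmetric] by (rule someI)
  then show r: "mm_space (representative \<X>)"
    by (simp add: mm_class_def)
  have "mm_iso (representative \<X>) X"
    using \<open>representative \<X> \<in> mm_class X\<close> by (simp add: mm_class_def)
  then have "class_of (representative \<X>) = Abs_MM (members \<X>)"
    using X mm_class_eq_iff[OF r X(1)] by (simp add: class_of_def)
  then show "class_of (representative \<X>) = \<X>"
    by (simp add: members_inverse)
qed

theorem class_of_add:
  fixes Y :: "'a mmspace" and Z :: "'b mmspace"
  assumes Y: "mm_space Y" and Z: "mm_space Z"
  shows "class_of Y \<boxplus> class_of Z = class_of (mm_sum Y Z)"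
proof -
  let ?R = "representative (class_of Y)" and ?S = "representative (class_of Z)"
  have "mm_iso ?R Y" "mm_iso ?S Z"
    using representative class_of_eq_iff Y Z by blast+
  then have "mm_iso (mm_sum ?R ?S) (mm_sum Y Z)"
    using Y Z representative by (intro mm_sum_cong) auto
  then show ?thesis
    unfolding MM_add_def
    by (subst class_of_eq_iff) (simp_all add: mm_space_sum Y Z representative(1))
qed

section \<open>Infinite divisibility\<close>

text \<open>The iteration adds \<open>n - 1\<close> further copies of \<open>\<Y>\<close> to one copy, which makes \<open>n\<close> summands.\<close>

definition infinitely_divisible :: "MM \<Rightarrow> bool" where
  "infinitely_divisible \<X> \<longleftrightarrow>
     (\<forall>n\<ge>2. \<exists>\<Y>. \<X> = ((\<lambda>\<Z>. \<Z> \<boxplus> \<Y>) ^^ (n - 1)) \<Y>)"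

end

theory Submission
  imports Defs
begin

text \<open>
  Write an infinitely divisible space \<open>X\<close> as a sum of \<open>n\<close> copies of \<open>X\<^sub>n\<close> and sample four
  independent points \<open>a, b, c, d\<close>. The distances between them are sums over the \<open>n\<close> coordinates.
  For large \<open>n\<close> each \<open>X\<^sub>n\<close> is concentrated near a single point up to probability of order \<open>1/n\<close>, so in
  a given coordinate two of the samples are away from that point only with probability of order
  \<open>1/n\<^sup>2\<close>. In the limit \<open>r(a, b)\<close> therefore splits as \<open>J(a) + J(b)\<close>, where \<open>J\<close> collects the deviations of
  a single sample, and so \<open>r(a, b) + r(c, d) = r(a, c) + r(b, d)\<close> almost surely. By full
  support the samples \<open>a, c\<close> are with positive probability close to one given point, and \<open>b, d\<close> close to
  another; the identity then says that the two given points coincide.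

  The proof makes this quantitative with two functionals of a metric measure space. The
  Laplace transform of the distance between two random points is multiplicative
  (\<open>distance_laplace_sum\<close>) and measures how concentrated \<open>X\<^sub>n\<close> is. The mean of the truncated
  defect \<open>\<bar>r(a, b) + r(c, d) - r(a, c) - r(b, d)\<bar>\<close> is subadditive (\<open>mean_defect_sum\<close>), so it is at most
  \<open>n\<close> times its value for \<open>X\<^sub>n\<close>. The decisive observation is that the defect is at most
  \<open>2 min (r(a, d)) (r(b, c))\<close> (\<open>crossing_defect_le\<close>), and these two distances are independent: the
  minimum is large only if both are, which has a probability that is quadratically small
  (\<open>mean_defect_le\<close>).

  This does not yet exclude that all distances in \<open>X\<^sub>n\<close> are about \<open>\<kappa>/n\<close>, a deterministic drift
  that would add up to \<open>\<kappa>\<close> in \<open>X\<close>. But two random points of \<open>X\<close> are arbitrarily close with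
  positive probability, which bounds the Laplace transform at \<open>s\<close> from below by \<open>c exp (-s \<epsilon>)\<close> with
  arbitrarily small \<open>\<epsilon>\<close> (\<open>distance_laplace_lower_bound\<close>) and leaves no room for a drift.
\<close>

section \<open>Integrals over squares of probability spaces\<close>

lemma integral_prod_mult:
  fixes f :: "'a \<Rightarrow> real" and g :: "'b \<Rightarrow> real"
  assumes M: "prob_space M" and N: "prob_space N"
    and f: "integrable M f" and g: "integrable N g"
  shows "(\<integral>p. f (fst p) * g (snd p) \<partial>(M \<Otimes>\<^sub>M N)) = (\<integral>x. f x \<partial>M) * (\<integral>y. g y \<partial>N)"
    and "integrable (M \<Otimes>\<^sub>M N) (\<lambda>p. f (fst p) * g (snd p))"
proof -
  interpret M: prob_space M by fact
  interpret N: prob_space N by fact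
  interpret P: pair_prob_space M N ..
  have [measurable]: "f \<in> borel_measurable M" "g \<in> borel_measurable N" using f g by auto
  show int: "integrable (M \<Otimes>\<^sub>M N) (\<lambda>p. f (fst p) * g (snd p))"
    by (rule P.Fubini_integrable) (use f g in \<open>auto simp: abs_mult\<close>)
  show "(\<integral>p. f (fst p) * g (snd p) \<partial>(M \<Otimes>\<^sub>M N)) = (\<integral>x. f x \<partial>M) * (\<integral>y. g y \<partial>N)"
    using P.integral_fst'[OF int] by simp
qed

lemma distr_map_prod:
  assumes f: "f \<in> measurable M M'" "distr M M' f = M'" and M': "prob_space M'"
  shows "distr (M \<Otimes>\<^sub>M M) (M' \<Otimes>\<^sub>M M') (map_prod f f) = M' \<Otimes>\<^sub>M M'"
proof -
  have "sigma_finite_measure (distr M M' f)"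
    unfolding f(2) using M' by (simp add: prob_space_imp_sigma_finite)
  then show ?thesis
    using pair_measure_distr[OF f(1) f(1)] by (simp add: f(2) map_prod_def)
qed

lemma measurable_map_prod_square:
  "f \<in> measurable M M' \<Longrightarrow> map_prod f f \<in> measurable (M \<Otimes>\<^sub>M M) (M' \<Otimes>\<^sub>M M')"
  by (simp add: map_prod_def split_beta')

lemma prob_space_square: "prob_space M \<Longrightarrow> prob_space (M \<Otimes>\<^sub>M M)"
  by (simp add: prob_space_pair)

lemma distr_pair_snd:
  assumes "prob_space M" "prob_space N"
  shows "distr (M \<Otimes>\<^sub>M N) N snd = N"
proof -
  interpret M: prob_space M by fact
  interpret N: prob_space N by fact
  show ?thesis
  proof (rule measure_eqI)
    fix A assume A: "A \<in> sets (distr (M \<Otimes>\<^sub>M N) N snd)"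
    then have "emeasure (distr (M \<Otimes>\<^sub>M N) N snd) A = emeasure (M \<Otimes>\<^sub>M N) (space M \<times> A)"
      by (auto simp: emeasure_distr space_pair_measure dest: sets.sets_into_space intro!: arg_cong2[where f=emeasure])
    with A show "emeasure (distr (M \<Otimes>\<^sub>M N) N snd) A = emeasure N A"
      by (simp add: N.emeasure_pair_measure_Times M.emeasure_space_1)
  qed simp
qed

section \<open>Random distances\<close>

text \<open>
  The set where the distance is below a given bound is open for the sum metric on pairs. It is
  measurable for the product \<open>\<sigma>\<close>-algebra because separability makes that \<open>\<sigma>\<close>-algebra the Borel one.
\<close>

lemma measurable_mdist:
  assumes X: "mm_space X"
    and f: "f \<in> measurable N (snd X)" and g: "g \<in> measurable N (snd X)"
  shows "(\<lambda>x. mdist (fst X) (f x) (g x)) \<in> borel_measurable N"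
proof -
  define m where "m = fst X"
  have sets: "sets (snd X \<Otimes>\<^sub>M snd X) = sets (mborel (sum_metric m m))"
    using mm_space_sum[OF X X] by (simp add: mm_space_def mm_sum_def m_def)
  have "(\<lambda>p. mdist m (fst p) (snd p)) \<in> borel_measurable (snd X \<Otimes>\<^sub>M snd X)"
  proof (rule borel_measurableI_less)
    fix a :: real
    have "openin (mtopology_of (sum_metric m m))
      {p \<in> mspace m \<times> mspace m. mdist m (fst p) (snd p) < a}" (is "openin _ ?U")
      unfolding openin_mtopology_of
    proof (intro conjI ballI)
      fix p assume p: "p \<in> ?U"
      let ?r = "a - mdist m (fst p) (snd p)"
      have "mball_of (sum_metric m m) p ?r \<subseteq> ?U"
      proof
        fix q assume "q \<in> mball_of (sum_metric m m) p ?r"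
        then have q: "q \<in> mspace m \<times> mspace m"
            "mdist m (fst p) (fst q) + mdist m (snd p) (snd q) < ?r"
          by (auto simp: mem_Times_iff)
        have "mdist m (fst q) (snd q) \<le> mdist m (fst q) (fst p) + mdist m (fst p) (snd q)"
          "mdist m (fst p) (snd q) \<le> mdist m (fst p) (snd p) + mdist m (snd p) (snd q)"
          using p q by (auto intro!: mdist_triangle simp: mem_Times_iff)
        then show "q \<in> ?U" using q by (simp add: mdist_commute)
      qed
      moreover have "?r > 0" using p by simp
      ultimately show "\<exists>r>0. mball_of (sum_metric m m) p r \<subseteq> ?U" by blast
    qed auto
    then have "?U \<in> sets (snd X \<Otimes>\<^sub>M snd X)"
      unfolding sets by (rule open_in_mborel)
    also have "?U = {p \<in> space (snd X \<Otimes>\<^sub>M snd X). mdist m (fst p) (snd p) < a}"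
      using mm_space_space[OF X] by (simp add: space_pair_measure m_def)
    finally show "{p \<in> space (snd X \<Otimes>\<^sub>M snd X). mdist m (fst p) (snd p) < a}
      \<in> sets (snd X \<Otimes>\<^sub>M snd X)" .
  qed
  from measurable_compose[OF measurable_Pair[OF f g] this] show ?thesis by (simp add: m_def)
qed

definition distance_laplace :: "real \<Rightarrow> 'a mmspace \<Rightarrow> real" where
  "distance_laplace s X =
     (\<integral>p. exp (- s * mdist (fst X) (fst p) (snd p)) \<partial>(snd X \<Otimes>\<^sub>M snd X))"

lemma measurable_exp_mdist:
  assumes "mm_space X"
  shows "(\<lambda>p. exp (- s * mdist (fst X) (fst p) (snd p))) \<in> borel_measurable (snd X \<Otimes>\<^sub>M snd X)"
  using measurable_mdist[OF assms measurable_fst measurable_snd] by measurable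

lemma integrable_exp_mdist:
  assumes "mm_space X" "s \<ge> 0"
  shows "integrable (snd X \<Otimes>\<^sub>M snd X) (\<lambda>p. exp (- s * mdist (fst X) (fst p) (snd p)))"
proof -
  interpret prob_space "snd X \<Otimes>\<^sub>M snd X"
    by (rule prob_space_square[OF mm_space_prob[OF assms(1)]])
  show ?thesis
    by (rule integrable_const_bound[where B = 1])
      (insert assms(2), simp, rule measurable_exp_mdist[OF assms(1)])
qed

lemma distance_laplace_le_1:
  assumes "mm_space X" "s \<ge> 0"
  shows "distance_laplace s X \<le> 1"
proof -
  interpret prob_space "snd X \<Otimes>\<^sub>M snd X"
    by (rule prob_space_square[OF mm_space_prob[OF assms(1)]])
  show ?thesis unfolding distance_laplace_def
    by (rule integral_le_const[OF integrable_exp_mdist[OF assms]]) (use assms(2) in auto)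
qed

lemma distance_laplace_cong:
  assumes "mm_iso X Y" "mm_space X" "mm_space Y"
  shows "distance_laplace s X = distance_laplace s Y"
proof -
  obtain f where f: "\<And>x x'. x \<in> mspace (fst X) \<Longrightarrow> x' \<in> mspace (fst X) \<Longrightarrow>
       mdist (fst Y) (f x) (f x') = mdist (fst X) x x'"
    "f \<in> measurable (snd X) (snd Y)" "distr (snd X) (snd Y) f = snd Y"
    using mm_isoD[OF assms] by blast
  have "distance_laplace s Y = (\<integral>p. exp (- s * mdist (fst Y) (fst p) (snd p))
      \<partial>distr (snd X \<Otimes>\<^sub>M snd X) (snd Y \<Otimes>\<^sub>M snd Y) (map_prod f f))"
    by (simp only: distance_laplace_def distr_map_prod[OF f(2,3) mm_space_prob[OF assms(3)]])
  also have "\<dots> = (\<integral>p. exp (- s * mdist (fst Y) (f (fst p)) (f (snd p))) \<partial>(snd X \<Otimes>\<^sub>M snd X))"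
    by (subst integral_distr[OF measurable_map_prod_square[OF f(2)] measurable_exp_mdist[OF assms(3)]])
      simp
  also have "\<dots> = distance_laplace s X"
    unfolding distance_laplace_def
    by (rule Bochner_Integration.integral_cong)
      (auto simp: f(1) space_pair_measure mm_space_space[OF assms(2)])
  finally show ?thesis ..
qed

text \<open>
  Distances add up over the two factors, whose coordinates are independent. The four coordinates
  have to be regrouped from pairs of points into pairs of coordinates, hence the iterated integrals.
\<close>

lemma distance_laplace_sum:
  fixes Y :: "'a mmspace" and Z :: "'b mmspace"
  assumes Y: "mm_space Y" and Z: "mm_space Z" and s: "s \<ge> 0"
  shows "distance_laplace s (mm_sum Y Z) = distance_laplace s Y * distance_laplace s Z"
proof -
  define M where "M = snd Y"
  define N where "N = snd Z"
  have pM: "prob_space M" and pN: "prob_space N"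
    unfolding M_def N_def using mm_space_prob[OF Y] mm_space_prob[OF Z] by blast+
  interpret M: prob_space M by (rule pM)
  interpret N: prob_space N by (rule pN)
  interpret MM: pair_prob_space M M ..
  interpret NN: pair_prob_space N N ..
  interpret MN: pair_prob_space M N ..
  interpret P: pair_prob_space "M \<Otimes>\<^sub>M N" "M \<Otimes>\<^sub>M N" ..
  define A where "A = (\<lambda>p. exp (- s * mdist (fst Y) (fst p) (snd p)))"
  define B where "B = (\<lambda>p. exp (- s * mdist (fst Z) (fst p) (snd p)))"
  have A: "integrable (M \<Otimes>\<^sub>M M) A" and B: "integrable (N \<Otimes>\<^sub>M N) B"
    unfolding A_def B_def M_def N_def by (rule integrable_exp_mdist; fact)+
  have [measurable]: "A \<in> borel_measurable (M \<Otimes>\<^sub>M M)" "B \<in> borel_measurable (N \<Otimes>\<^sub>M N)"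
    using A B by auto
  have A1: "integrable M (\<lambda>y'. A (y, y'))" if "y \<in> space M" for y
    by (rule M.integrable_const_bound[where B = 1]) (insert that s, simp add: A_def, measurable)
  have B1: "integrable N (\<lambda>z'. B (z, z'))" if "z \<in> space N" for z
    by (rule N.integrable_const_bound[where B = 1]) (insert that s, simp add: B_def, measurable)
  have "distance_laplace s (mm_sum Y Z) =
      (\<integral>u. A (fst (fst u), fst (snd u)) * B (snd (fst u), snd (snd u)) \<partial>((M \<Otimes>\<^sub>M N) \<Otimes>\<^sub>M (M \<Otimes>\<^sub>M N)))"
    unfolding distance_laplace_def mm_sum_def fst_conv snd_conv M_def N_def
    by (rule Bochner_Integration.integral_cong) (simp_all add: A_def B_def exp_add[symmetric] algebra_simps)
  also have "\<dots> = (\<integral>p. (\<integral>q. A (fst p, fst q) * B (snd p, snd q) \<partial>(M \<Otimes>\<^sub>M N)) \<partial>(M \<Otimes>\<^sub>M N))"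
  proof -
    have "integrable ((M \<Otimes>\<^sub>M N) \<Otimes>\<^sub>M (M \<Otimes>\<^sub>M N))
        (\<lambda>u. A (fst (fst u), fst (snd u)) * B (snd (fst u), snd (snd u)))"
    proof (rule P.integrable_const_bound[of _ 1])
      show "AE u in (M \<Otimes>\<^sub>M N) \<Otimes>\<^sub>M (M \<Otimes>\<^sub>M N).
          norm (A (fst (fst u), fst (snd u)) * B (snd (fst u), snd (snd u))) \<le> 1"
        using s by (auto simp: A_def B_def abs_mult intro!: mult_le_one)
    qed measurable
    from P.integral_fst'[OF this] show ?thesis by simp
  qed
  also have "\<dots> = (\<integral>p. (\<integral>y'. A (fst p, y') \<partial>M) * (\<integral>z'. B (snd p, z') \<partial>N) \<partial>(M \<Otimes>\<^sub>M N))"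
    by (intro Bochner_Integration.integral_cong refl integral_prod_mult(1)[OF pM pN] A1 B1)
      (auto simp: space_pair_measure)
  also have "\<dots> = (\<integral>y. (\<integral>y'. A (y, y') \<partial>M) \<partial>M) * (\<integral>z. (\<integral>z'. B (z, z') \<partial>N) \<partial>N)"
    by (intro integral_prod_mult(1)[OF pM pN] MM.integrable_fst'[OF A] NN.integrable_fst'[OF B])
  also have "\<dots> = (\<integral>p. A p \<partial>(M \<Otimes>\<^sub>M M)) * (\<integral>p. B p \<partial>(N \<Otimes>\<^sub>M N))"
    by (simp add: MM.integral_fst'[OF A] NN.integral_fst'[OF B])
  finally show ?thesis by (simp add: distance_laplace_def A_def B_def M_def N_def)
qed

lemma ball_pos_measure:
  assumes X: "mm_space X" and x: "x \<in> mspace (fst X)" and r: "r > 0"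
  shows "measure (snd X) (mball_of (fst X) x r) > 0" "mball_of (fst X) x r \<in> sets (snd X)"
proof -
  interpret prob_space "snd X" by (rule mm_space_prob[OF X])
  have "mdist (fst X) x x = 0" using x by simp
  then have "x \<in> mball_of (fst X) x r" using x r by (simp only: in_mball_of)
  then have "emeasure (snd X) (mball_of (fst X) x r) > 0"
    using mm_space_support[OF X openin_mball_of] by blast
  then show "measure (snd X) (mball_of (fst X) x r) > 0"
    by (simp add: emeasure_eq_measure)
  show "mball_of (fst X) x r \<in> sets (snd X)"
    unfolding mm_space_sets[OF X] by (rule open_in_mborel[OF openin_mball_of])
qed

lemma mspace_nonempty:
  assumes "mm_space X"
  shows "mspace (fst X) \<noteq> {}"
  using prob_space.not_empty[OF mm_space_prob[OF assms]] mm_space_space[OF assms] by simp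

text \<open>
  Full support gives two random points a positive chance to fall into the same ball of radius
  \<open>e / 2\<close>. The rate \<open>e\<close> of exponential decay can thus be taken arbitrarily small, at the price of
  a smaller constant \<open>c\<close>.
\<close>

lemma distance_laplace_lower_bound:
  assumes X: "mm_space X" and e: "e > 0"
  shows "\<exists>c>0. \<forall>s\<ge>0. c * exp (- s * e) \<le> distance_laplace s X"
proof -
  obtain x where x: "x \<in> mspace (fst X)" using mspace_nonempty[OF X] by blast
  let ?B = "mball_of (fst X) x (e / 2)"
  let ?Q = "snd X \<Otimes>\<^sub>M snd X"
  have B: "measure (snd X) ?B > 0" "?B \<in> sets (snd X)"
    using ball_pos_measure[OF X x, of "e / 2"] e by auto
  interpret X: prob_space "snd X" by (rule mm_space_prob[OF X])
  interpret Q: pair_prob_space "snd X" "snd X" ..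
  have BB: "?B \<times> ?B \<in> sets ?Q" using B(2) by simp
  have m: "measure ?Q (?B \<times> ?B) = (measure (snd X) ?B)\<^sup>2"
    using X.emeasure_pair_measure_Times[OF B(2) B(2)]
    by (simp add: Q.emeasure_eq_measure X.emeasure_eq_measure ennreal_mult[symmetric] power2_eq_square)
  have "(measure (snd X) ?B)\<^sup>2 * exp (- s * e) \<le> distance_laplace s X" if s: "s \<ge> 0" for s
  proof -
    have "(measure (snd X) ?B)\<^sup>2 * exp (- s * e) = (\<integral>p. indicator (?B \<times> ?B) p * exp (- s * e) \<partial>?Q)"
      using BB by (simp add: m)
    also have "\<dots> \<le> distance_laplace s X"
      unfolding distance_laplace_def
    proof (rule integral_mono[OF _ integrable_exp_mdist[OF X s]])
      show "integrable ?Q (\<lambda>p. indicator (?B \<times> ?B) p * exp (- s * e))" 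
        using BB by (auto simp: less_top[symmetric])
      fix p assume "p \<in> space ?Q"
      show "indicator (?B \<times> ?B) p * exp (- s * e) \<le> exp (- s * mdist (fst X) (fst p) (snd p))"
      proof (cases "p \<in> ?B \<times> ?B")
        case True
        then have q: "fst p \<in> mspace (fst X)" "snd p \<in> mspace (fst X)"
          "mdist (fst X) x (fst p) < e / 2" "mdist (fst X) x (snd p) < e / 2"
          by (auto simp: mem_Times_iff)
        have "mdist (fst X) (fst p) (snd p) \<le> mdist (fst X) (fst p) x + mdist (fst X) x (snd p)"
          using q x by (intro mdist_triangle)
        then have "mdist (fst X) (fst p) (snd p) \<le> e" using q by (simp add: mdist_commute)
        then show ?thesis using True s by (simp add: mult_left_mono)
      qed simp
    qed
    finally show ?thesis .
  qed
  moreover have "(measure (snd X) ?B)\<^sup>2 > 0" using B(1) by simp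
  ultimately show ?thesis by blast
qed

section \<open>The crossing defect of four random points\<close>

text \<open>
  The points are grouped as \<open>(a, d)\<close> and \<open>(b, c)\<close> because it is the distances within these two pairs
  that bound the defect: on a product of two copies of the squared measure they are functions of
  different factors, hence independent.
\<close>

definition crossing_defect :: "'a metric \<Rightarrow> ('a \<times> 'a) \<times> 'a \<times> 'a \<Rightarrow> real" where
  "crossing_defect m p = (case p of ((a, d), (b, c)) \<Rightarrow>
     \<bar>mdist m a b + mdist m c d - mdist m a c - mdist m b d\<bar>)"

definition mean_defect :: "'a mmspace \<Rightarrow> real" where
  "mean_defect X = (\<integral>p. min 1 (crossing_defect (fst X) p)
     \<partial>((snd X \<Otimes>\<^sub>M snd X) \<Otimes>\<^sub>M (snd X \<Otimes>\<^sub>M snd X)))"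

lemma measurable_min_defect:
  assumes "mm_space X"
  shows "(\<lambda>p. min 1 (crossing_defect (fst X) p))
    \<in> borel_measurable ((snd X \<Otimes>\<^sub>M snd X) \<Otimes>\<^sub>M (snd X \<Otimes>\<^sub>M snd X))"
proof -
  note [measurable (raw)] = measurable_mdist[OF assms]
  show ?thesis unfolding crossing_defect_def split_beta' by measurable
qed

lemma crossing_defect_nonneg: "crossing_defect m p \<ge> 0"
  by (simp add: crossing_defect_def split_beta')

lemma integrable_min_defect:
  assumes "mm_space X"
  shows "integrable ((snd X \<Otimes>\<^sub>M snd X) \<Otimes>\<^sub>M (snd X \<Otimes>\<^sub>M snd X)) (\<lambda>p. min 1 (crossing_defect (fst X) p))"
proof -
  interpret prob_space "(snd X \<Otimes>\<^sub>M snd X) \<Otimes>\<^sub>M (snd X \<Otimes>\<^sub>M snd X)"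
    by (intro prob_space_square mm_space_prob assms)
  show ?thesis
    by (rule integrable_const_bound[of _ 1])
      (auto intro!: measurable_min_defect[OF assms] simp: crossing_defect_nonneg)
qed

text \<open>
  Both isomorphisms and the projections of a sum onto its factors preserve measure; this is the
  common change of variables.
\<close>

lemma mean_defect_pushforward:
  assumes Y: "mm_space Y" and f: "f \<in> measurable M (snd Y)" "distr M (snd Y) f = snd Y"
    and M: "prob_space M"
  defines "F \<equiv> map_prod (map_prod f f) (map_prod f f)"
  shows "(\<integral>p. min 1 (crossing_defect (fst Y) (F p)) \<partial>((M \<Otimes>\<^sub>M M) \<Otimes>\<^sub>M (M \<Otimes>\<^sub>M M))) = mean_defect Y"
    and "integrable ((M \<Otimes>\<^sub>M M) \<Otimes>\<^sub>M (M \<Otimes>\<^sub>M M)) (\<lambda>p. min 1 (crossing_defect (fst Y) (F p)))"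
proof -
  have ff: "map_prod f f \<in> measurable (M \<Otimes>\<^sub>M M) (snd Y \<Otimes>\<^sub>M snd Y)"
    "distr (M \<Otimes>\<^sub>M M) (snd Y \<Otimes>\<^sub>M snd Y) (map_prod f f) = snd Y \<Otimes>\<^sub>M snd Y"
    using measurable_map_prod_square[OF f(1)] distr_map_prod[OF f mm_space_prob[OF Y]] by auto
  have F: "F \<in> measurable ((M \<Otimes>\<^sub>M M) \<Otimes>\<^sub>M (M \<Otimes>\<^sub>M M)) ((snd Y \<Otimes>\<^sub>M snd Y) \<Otimes>\<^sub>M (snd Y \<Otimes>\<^sub>M snd Y))"
    "distr ((M \<Otimes>\<^sub>M M) \<Otimes>\<^sub>M (M \<Otimes>\<^sub>M M)) ((snd Y \<Otimes>\<^sub>M snd Y) \<Otimes>\<^sub>M (snd Y \<Otimes>\<^sub>M snd Y)) F =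
      (snd Y \<Otimes>\<^sub>M snd Y) \<Otimes>\<^sub>M (snd Y \<Otimes>\<^sub>M snd Y)"
    unfolding F_def using measurable_map_prod_square[OF ff(1)]
      distr_map_prod[OF ff prob_space_square[OF mm_space_prob[OF Y]]] by auto
  show "(\<integral>p. min 1 (crossing_defect (fst Y) (F p)) \<partial>((M \<Otimes>\<^sub>M M) \<Otimes>\<^sub>M (M \<Otimes>\<^sub>M M))) = mean_defect Y"
    using integral_distr[OF F(1) measurable_min_defect[OF Y]] by (simp add: F(2) mean_defect_def)
  show "integrable ((M \<Otimes>\<^sub>M M) \<Otimes>\<^sub>M (M \<Otimes>\<^sub>M M)) (\<lambda>p. min 1 (crossing_defect (fst Y) (F p)))"
    using integrable_min_defect[OF Y] integrable_distr_eq[OF F(1) measurable_min_defect[OF Y]]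
    by (simp add: F(2))
qed

lemma mean_defect_cong:
  assumes "mm_iso X Y" "mm_space X" "mm_space Y"
  shows "mean_defect X = mean_defect Y"
proof -
  obtain f where f: "\<And>x x'. x \<in> mspace (fst X) \<Longrightarrow> x' \<in> mspace (fst X) \<Longrightarrow>
       mdist (fst Y) (f x) (f x') = mdist (fst X) x x'"
    "f \<in> measurable (snd X) (snd Y)" "distr (snd X) (snd Y) f = snd Y"
    using mm_isoD[OF assms] by blast
  have "mean_defect X = (\<integral>p. min 1 (crossing_defect (fst Y)
      (map_prod (map_prod f f) (map_prod f f) p)) \<partial>((snd X \<Otimes>\<^sub>M snd X) \<Otimes>\<^sub>M (snd X \<Otimes>\<^sub>M snd X)))"
    unfolding mean_defect_def
    by (rule Bochner_Integration.integral_cong)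
      (auto simp: crossing_defect_def f(1) space_pair_measure mm_space_space[OF assms(2)])
  then show ?thesis
    using mean_defect_pushforward(1)[OF assms(3) f(2,3) mm_space_prob[OF assms(2)]] by simp
qed

text \<open>
  The quantity inside the absolute value is additive over the factors, so the triangle inequality
  makes the defect subadditive, and truncation at 1 preserves subadditivity.
\<close>

lemma mean_defect_sum:
  fixes Y :: "'a mmspace" and Z :: "'b mmspace"
  assumes Y: "mm_space Y" and Z: "mm_space Z"
  shows "mean_defect (mm_sum Y Z) \<le> mean_defect Y + mean_defect Z"
proof -
  let ?M = "snd Y \<Otimes>\<^sub>M snd Z"
  let ?P = "(?M \<Otimes>\<^sub>M ?M) \<Otimes>\<^sub>M (?M \<Otimes>\<^sub>M ?M)"
  let ?F = "\<lambda>p. min 1 (crossing_defect (fst Y) (map_prod (map_prod fst fst) (map_prod fst fst) p))"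
  let ?G = "\<lambda>p. min 1 (crossing_defect (fst Z) (map_prod (map_prod snd snd) (map_prod snd snd) p))"
  have pY: "prob_space (snd Y)" and pZ: "prob_space (snd Z)" and pM: "prob_space ?M"
    using mm_space_prob[OF Y] mm_space_prob[OF Z] by (blast intro: prob_space_pair)+
  note F = mean_defect_pushforward[OF Y measurable_fst prob_space.distr_pair_fst[OF pZ] pM]
  note G = mean_defect_pushforward[OF Z measurable_snd distr_pair_snd[OF pY pZ] pM]
  have "mean_defect (mm_sum Y Z) \<le> (\<integral>p. ?F p + ?G p \<partial>?P)"
    unfolding mean_defect_def mm_sum_def fst_conv snd_conv
  proof (rule integral_mono)
    show "integrable ?P (\<lambda>p. min 1 (crossing_defect (sum_metric (fst Y) (fst Z)) p))"
      using integrable_min_defect[OF mm_space_sum[OF Y Z]] by (simp add: mm_sum_def)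
    show "integrable ?P (\<lambda>p. ?F p + ?G p)" using F(2) G(2) by simp
    show "min 1 (crossing_defect (sum_metric (fst Y) (fst Z)) p) \<le> ?F p + ?G p" for p
      by (cases p) (auto simp: crossing_defect_def)
  qed
  also have "\<dots> = mean_defect Y + mean_defect Z"
    using F G by simp
  finally show ?thesis .
qed

text \<open>
  The signed defect can be paired as \<open>(r(a, b) - r(a, c)) + (r(c, d) - r(b, d))\<close>, where both
  differences are at most \<open>r(b, c)\<close> in absolute value, or as \<open>(r(a, b) - r(b, d)) + (r(c, d) - r(a, c))\<close>, where both
  are at most \<open>r(a, d)\<close>.
\<close>

lemma crossing_defect_le:
  assumes "a \<in> mspace m" "b \<in> mspace m" "c \<in> mspace m" "d \<in> mspace m"
  shows "crossing_defect m ((a, d), (b, c)) \<le> 2 * min (mdist m a d) (mdist m b c)"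
proof -
  have "mdist m a b \<le> mdist m a c + mdist m c b" "mdist m a c \<le> mdist m a b + mdist m b c"
    "mdist m d b \<le> mdist m d c + mdist m c b" "mdist m d c \<le> mdist m d b + mdist m b c"
    "mdist m b a \<le> mdist m b d + mdist m d a" "mdist m b d \<le> mdist m b a + mdist m a d"
    "mdist m c a \<le> mdist m c d + mdist m d a" "mdist m c d \<le> mdist m c a + mdist m a d"
    using assms by (auto intro: mdist_triangle)
  then show ?thesis
    unfolding crossing_defect_def split_conv
      mdist_commute[of m b a] mdist_commute[of m c a] mdist_commute[of m d a]
      mdist_commute[of m c b] mdist_commute[of m d b] mdist_commute[of m d c]
    by linarith
qed

lemma min_1_le_exp:
  fixes t :: real
  assumes "t \<ge> 0"
  shows "min t 1 \<le> 2 * (1 - exp (- t))"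
proof -
  have e: "exp (- t) \<le> 1 / (1 + t)"
    using exp_ge_add_one_self[of t] assms by (simp add: exp_minus field_simps)
  have "min t 1 \<le> 2 * (1 - 1 / (1 + t))"
    using assms mult_left_le[of t t] by (auto simp: min_def field_simps)
  also have "\<dots> \<le> 2 * (1 - exp (- t))" using e by simp
  finally show ?thesis .
qed

text \<open>
  If \<open>y\<close> or \<open>y'\<close> is at most the threshold \<open>d\<close>, the minimum is at most \<open>d\<close> times \<open>min (y / d) 1\<close>;
  otherwise both \<open>min (y / d) 1\<close> and \<open>min (y' / d) 1\<close> are 1. In the form with exponentials, the
  expectations on the right are Laplace transforms, and for independent \<open>y, y'\<close> the last term factorises.
\<close>

lemma min_le_exp_products:
  fixes y y' d :: real
  assumes y: "y \<ge> 0" "y' \<ge> 0" and d: "d > 0"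
  shows "min 1 (2 * min y' y) \<le> 4 * d * (1 - exp (- (1 / d) * y))
    + 8 * ((1 - exp (- (1 / d) * y')) * (1 - exp (- (1 / d) * y)))"
proof -
  define u where "u = min (y / d) 1"
  define u' where "u' = min (y' / d) 1"
  define v where "v = 1 - exp (- (1 / d) * y)"
  define v' where "v' = 1 - exp (- (1 / d) * y')"
  have u: "0 \<le> u" "0 \<le> u'" using y d by (auto simp: u_def u'_def)
  have uv: "u \<le> 2 * v" "u' \<le> 2 * v'"
    using min_1_le_exp[of "y / d"] min_1_le_exp[of "y' / d"] y d
    by (auto simp: u_def u'_def v_def v'_def)
  have "min 1 (2 * min y' y) \<le> 2 * (d * u + u' * u)"
  proof (cases "y \<le> d")
    case True
    then have "d * u = y" using d by (auto simp: u_def min_def field_simps)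
    moreover have "u' * u \<ge> 0" using u by simp
    moreover have "min 1 (2 * min y' y) \<le> 2 * y" by simp
    ultimately show ?thesis unfolding distrib_left by linarith
  next
    case False
    then have u1: "u = 1" using d by (auto simp: u_def min_def field_simps)
    show ?thesis
    proof (cases "y' \<le> d")
      case True
      then show ?thesis using u u1 by auto
    next
      case False
      then have "u' = 1" using d by (auto simp: u'_def min_def field_simps)
      then show ?thesis using u1 d by auto
    qed
  qed
  also have "d * u \<le> d * (2 * v)" using uv d by simp
  also have "u' * u \<le> (2 * v') * (2 * v)" using uv u by (intro mult_mono) auto
  finally show ?thesis by (simp add: v_def v'_def algebra_simps)
qed

text \<open>
  For the \<open>n\<close>-th part of an infinitely divisible space, \<open>A\<close> is of order \<open>1/n\<close>. After multiplication by
  \<open>n\<close> the quadratic term vanishes as \<open>n\<close> grows, and the linear one is controlled by the choice of \<open>d\<close>.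
\<close>

lemma mean_defect_le:
  assumes X: "mm_space X" and d: "d > 0"
  defines "A \<equiv> 1 - distance_laplace (1 / d) X"
  shows "mean_defect X \<le> 4 * d * A + 8 * A\<^sup>2"
proof -
  let ?Q = "snd X \<Otimes>\<^sub>M snd X"
  define v where "v = (\<lambda>p. 1 - exp (- (1 / d) * mdist (fst X) (fst p) (snd p)))"
  have pQ: "prob_space ?Q" by (rule prob_space_square[OF mm_space_prob[OF X]])
  interpret Q: prob_space ?Q by (rule pQ)
  have e: "integrable ?Q (\<lambda>p. exp (- (1 / d) * mdist (fst X) (fst p) (snd p)))"
    by (rule integrable_exp_mdist[OF X]) (use d in simp)
  then have v: "integrable ?Q v" unfolding v_def by simp
  have A: "(\<integral>p. v p \<partial>?Q) = A"
    using e unfolding v_def A_def distance_laplace_def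
    by (subst Bochner_Integration.integral_diff) (simp_all add: Q.prob_space)
  note I1 = integral_prod_mult[OF pQ pQ _ v, of "\<lambda>_. 1", simplified]
  note I2 = integral_prod_mult[OF pQ pQ v v]
  have "mean_defect X \<le> (\<integral>p. 4 * d * v (snd p) + 8 * (v (fst p) * v (snd p)) \<partial>(?Q \<Otimes>\<^sub>M ?Q))"
    unfolding mean_defect_def
  proof (rule integral_mono[OF integrable_min_defect[OF X]])
    show "integrable (?Q \<Otimes>\<^sub>M ?Q) (\<lambda>p. 4 * d * v (snd p) + 8 * (v (fst p) * v (snd p)))"
      using I1(2) I2(2) by simp
    fix p assume p: "p \<in> space (?Q \<Otimes>\<^sub>M ?Q)"
    obtain a b c d' where p_eq: "p = ((a, d'), (b, c))" by (metis surj_pair)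
    have "crossing_defect (fst X) p \<le> 2 * min (mdist (fst X) a d') (mdist (fst X) b c)"
      unfolding p_eq using p
      by (intro crossing_defect_le) (auto simp: p_eq space_pair_measure mm_space_space[OF X])
    then have "min 1 (crossing_defect (fst X) p)
        \<le> min 1 (2 * min (mdist (fst X) a d') (mdist (fst X) b c))" by simp
    also have "\<dots> \<le> 4 * d * v (snd p) + 8 * (v (fst p) * v (snd p))"
      unfolding v_def p_eq fst_conv snd_conv by (rule min_le_exp_products) (use d in auto)
    finally show "min 1 (crossing_defect (fst X) p) \<le> 4 * d * v (snd p) + 8 * (v (fst p) * v (snd p))" .
  qed
  also have "\<dots> = 4 * d * A + 8 * A\<^sup>2"
    using I1 I2 by (simp add: A Q.prob_space power2_eq_square)
  finally show ?thesis .
qed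

lemma mean_defect_zero_imp_singleton:
  assumes X: "mm_space X" and zero: "mean_defect X \<le> 0"
  shows "\<exists>x. mspace (fst X) = {x}"
proof -
  obtain x where x: "x \<in> mspace (fst X)" using mspace_nonempty[OF X] by blast
  have "y = x" if y: "y \<in> mspace (fst X)" for y
  proof (rule ccontr)
    assume "y \<noteq> x"
    \<comment> \<open>With \<open>a, c\<close> within \<open>r / 8\<close> of \<open>x\<close> and \<open>b, d\<close> within \<open>r / 8\<close> of \<open>y\<close>, the distances \<open>r(a, b)\<close> and
      \<open>r(c, d)\<close> are at least \<open>3 r / 4\<close> while \<open>r(a, c)\<close> and \<open>r(b, d)\<close> are at most \<open>r / 4\<close>, so the
      defect is at least \<open>r\<close>.\<close>
    define r where "r = mdist (fst X) x y"
    have "r > 0" using \<open>y \<noteq> x\<close> x y by (metis mdist_nonneg mdist_zero order_le_less r_def)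
    let ?B = "mball_of (fst X) x (r / 8)" and ?C = "mball_of (fst X) y (r / 8)"
    let ?M = "snd X"
    let ?P = "(?M \<Otimes>\<^sub>M ?M) \<Otimes>\<^sub>M (?M \<Otimes>\<^sub>M ?M)"
    let ?S = "(?B \<times> ?C) \<times> (?C \<times> ?B)"
    have B: "measure ?M ?B > 0" "?B \<in> sets ?M" and C: "measure ?M ?C > 0" "?C \<in> sets ?M"
      using ball_pos_measure[OF X] x y \<open>r > 0\<close> by auto
    interpret M: prob_space ?M by (rule mm_space_prob[OF X])
    interpret Q: pair_prob_space ?M ?M ..
    interpret P: pair_prob_space "?M \<Otimes>\<^sub>M ?M" "?M \<Otimes>\<^sub>M ?M" ..
    have S: "?S \<in> sets ?P" using B C by simp
    have "emeasure ?P ?S = (emeasure ?M ?B * emeasure ?M ?C) * (emeasure ?M ?C * emeasure ?M ?B)"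
      using B C by (simp add: Q.emeasure_pair_measure_Times M.emeasure_pair_measure_Times)
    also have "\<dots> > 0"
      using B(1) C(1) by (simp add: ennreal_zero_less_mult_iff M.emeasure_eq_measure)
    finally have S_pos: "measure ?P ?S > 0" by (simp add: P.emeasure_eq_measure)
    have "min 1 r * measure ?P ?S = (\<integral>p. min 1 r * indicator ?S p \<partial>?P)"
      using S by simp
    also have "\<dots> \<le> mean_defect X"
      unfolding mean_defect_def
    proof (rule integral_mono[OF _ integrable_min_defect[OF X]])
      show "integrable ?P (\<lambda>p. min 1 r * indicator ?S p)"
        using S by (auto simp: less_top[symmetric])
      fix p
      show "min 1 r * indicator ?S p \<le> min 1 (crossing_defect (fst X) p)"
      proof (cases "p \<in> ?S")
        case True
        then obtain a b c d where p: "p = ((a, d), (b, c))"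
          and abcd: "a \<in> ?B" "d \<in> ?C" "b \<in> ?C" "c \<in> ?B" by auto
        let ?d = "mdist (fst X)"
        have m: "a \<in> mspace (fst X)" "b \<in> mspace (fst X)" "c \<in> mspace (fst X)" "d \<in> mspace (fst X)"
          and near: "?d x a < r / 8" "?d x c < r / 8" "?d y b < r / 8" "?d y d < r / 8"
          using abcd by auto
        have "?d x y \<le> ?d x a + ?d a y" "?d a y \<le> ?d a b + ?d b y"
          "?d x y \<le> ?d x c + ?d c y" "?d c y \<le> ?d c d + ?d d y"
          "?d a c \<le> ?d a x + ?d x c" "?d b d \<le> ?d b y + ?d y d"
          using m x y by (auto intro: mdist_triangle)
        then have "r \<le> crossing_defect (fst X) p"
          using near mdist_commute[of "fst X" a x] mdist_commute[of "fst X" b y]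
            mdist_commute[of "fst X" d y] \<open>r > 0\<close>
          unfolding crossing_defect_def p split_conv r_def by linarith
        then show ?thesis using True by auto
      qed (simp add: crossing_defect_nonneg)
    qed
    finally have "min 1 r * measure ?P ?S \<le> 0" using zero by linarith
    moreover have "min 1 r * measure ?P ?S > 0" using S_pos \<open>r > 0\<close> by (intro mult_pos_pos) auto
    ultimately show False by linarith
  qed
  then show ?thesis using x by blast
qed

section \<open>Infinite divisibility\<close>

lemma representative_add_iso:
  "mm_iso (representative (\<Y> \<boxplus> \<Z>)) (mm_sum (representative \<Y>) (representative \<Z>))"
  using class_of_eq_iff[OF representative(1)[of "\<Y> \<boxplus> \<Z>"]
      mm_space_sum[OF representative(1)[of \<Y>] representative(1)[of \<Z>]]]
  by (simp add: representative(2) MM_add_def)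

lemma distance_laplace_iterated_add:
  assumes "s \<ge> 0"
  shows "distance_laplace s (representative (((\<lambda>\<Z>. \<Z> \<boxplus> \<Y>) ^^ k) \<Y>))
    = distance_laplace s (representative \<Y>) ^ Suc k"
proof (induction k)
  case (Suc k)
  then show ?case
    by (simp add: distance_laplace_cong[OF representative_add_iso representative(1)
          mm_space_sum[OF representative(1) representative(1)]]
        distance_laplace_sum representative(1) assms)
qed simp

lemma mean_defect_iterated_add:
  "mean_defect (representative (((\<lambda>\<Z>. \<Z> \<boxplus> \<Y>) ^^ k) \<Y>))
    \<le> real (Suc k) * mean_defect (representative \<Y>)"
proof (induction k)
  case (Suc k)
  let ?Z = "((\<lambda>\<Z>. \<Z> \<boxplus> \<Y>) ^^ k) \<Y>"
  have "mean_defect (representative (?Z \<boxplus> \<Y>))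
      \<le> mean_defect (representative ?Z) + mean_defect (representative \<Y>)"
    unfolding mean_defect_cong[OF representative_add_iso representative(1)
        mm_space_sum[OF representative(1) representative(1)]]
    by (intro mean_defect_sum representative)
  with Suc.IH show ?case by (simp add: algebra_simps)
qed simp

text \<open>
  For an \<open>n\<close>-th part \<open>\<Y>\<close> of \<open>\<X>\<close> put \<open>A = 1 - L(1/d)\<close>, where \<open>L\<close> is the Laplace transform for \<open>\<Y>\<close>.
  Multiplicativity and the lower bound for \<open>\<X>\<close> give \<open>c exp (- e / d) \<le> (1 - A)^n \<le> exp (- n A)\<close>, that is,
  \<open>n A \<le> e / d - ln c\<close>. Substituting this into \<open>n\<close> times \<open>mean_defect_le\<close> and letting
  \<open>n \<rightarrow> \<infinity>\<close>, then \<open>d \<rightarrow> 0\<close>, then \<open>e \<rightarrow> 0\<close> leaves nothing. The order matters: \<open>c\<close> depends on \<open>e\<close>, so that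
  \<open>d ln c\<close> vanishes only while \<open>e\<close> is kept fixed.
\<close>

lemma infinitely_divisible_mean_defect_le_0:
  assumes "infinitely_divisible \<X>"
  shows "mean_defect (representative \<X>) \<le> 0"
proof -
  let ?X = "representative \<X>"
  have key: "mean_defect ?X \<le> 4 * e" if e: "e > 0" for e
  proof -
    obtain c where c: "c > 0" "\<And>s. s \<ge> 0 \<Longrightarrow> c * exp (- s * e) \<le> distance_laplace s ?X"
      using distance_laplace_lower_bound[OF representative(1) e] by blast
    have bound: "mean_defect ?X \<le> 4 * d * (e / d - ln c) + 8 * (e / d - ln c)\<^sup>2 / real n"
      if d: "d > 0" and n: "n \<ge> 2" for d and n :: nat
    proof -
      obtain \<Y> where \<Y>: "\<X> = ((\<lambda>\<Z>. \<Z> \<boxplus> \<Y>) ^^ (n - 1)) \<Y>"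
        using assms n unfolding infinitely_divisible_def by blast
      define A where "A = 1 - distance_laplace (1 / d) (representative \<Y>)"
      have A0: "A \<ge> 0" unfolding A_def
        using distance_laplace_le_1[OF representative(1), of "1 / d"] d by simp
      have "c * exp (- (1 / d) * e) \<le> distance_laplace (1 / d) ?X"
        using c(2)[of "1 / d"] d by simp
      also have "\<dots> = (1 - A) ^ n"
        using distance_laplace_iterated_add[of "1 / d" "n - 1" \<Y>] d n by (simp add: \<Y>[simplified, symmetric] A_def)
      also have "\<dots> \<le> exp (- A) ^ n"
      proof (rule power_mono)
        show "1 - A \<le> exp (- A)" using exp_ge_add_one_self[of "- A"] by simp
        show "0 \<le> 1 - A" by (simp add: A_def distance_laplace_def)
      qed
      also have "\<dots> = exp (- (real n * A))" by (simp add: exp_of_nat_mult[symmetric])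
      finally have "ln (c * exp (- (1 / d) * e)) \<le> - (real n * A)"
        using c(1) by (metis exp_gt_zero ln_exp ln_le_cancel_iff mult_pos_pos)
      then have nA: "real n * A \<le> e / d - ln c" using c(1) by (simp add: ln_mult)
      have "mean_defect ?X \<le> real n * mean_defect (representative \<Y>)"
        using mean_defect_iterated_add[of "n - 1" \<Y>] n by (simp add: \<Y>[simplified, symmetric])
      also have "\<dots> \<le> real n * (4 * d * A + 8 * A\<^sup>2)"
        using mean_defect_le[OF representative(1) d] by (simp add: A_def mult_left_mono)
      also have "\<dots> = 4 * d * (real n * A) + 8 * (real n * A)\<^sup>2 / real n"
        using n by (simp add: field_simps power2_eq_square)
      also have "\<dots> \<le> 4 * d * (e / d - ln c) + 8 * (e / d - ln c)\<^sup>2 / real n"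
        using nA A0 d by (intro add_mono mult_left_mono divide_right_mono power_mono) auto
      finally show ?thesis .
    qed
    have bound': "mean_defect ?X \<le> 4 * e - 4 * d * ln c" if d: "d > 0" for d
    proof -
      have "(\<lambda>n. 4 * d * (e / d - ln c) + 8 * (e / d - ln c)\<^sup>2 / real n)
          \<longlonglongrightarrow> 4 * d * (e / d - ln c) + 0"
        by (intro tendsto_intros lim_const_over_n)
      then have "mean_defect ?X \<le> 4 * d * (e / d - ln c) + 0"
        by (rule tendsto_lowerbound)
          (auto intro!: eventually_mono[OF eventually_ge_at_top[of 2]] bound d)
      then show ?thesis using d by (simp add: algebra_simps)
    qed
    have "((\<lambda>d. 4 * e - 4 * d * ln c) \<longlongrightarrow> 4 * e - 4 * 0 * ln c) (at_right 0)"
      by (intro tendsto_intros)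
    then have "mean_defect ?X \<le> 4 * e - 4 * 0 * ln c"
      by (rule tendsto_lowerbound)
        (auto intro!: eventually_mono[OF eventually_at_right_less[of 0]] bound')
    then show ?thesis by simp
  qed
  show ?thesis
  proof (rule field_le_epsilon)
    fix e :: real assume "e > 0"
    then show "mean_defect ?X \<le> 0 + e" using key[of "e / 4"] by simp
  qed
qed

lemma singleton_iso_point:
  assumes X: "mm_space X" and x: "mspace (fst X) = {x}"
  shows "mm_iso X mm_point"
proof -
  have m: "mspace (fst mm_point) = UNIV" "mdist (fst mm_point) = (\<lambda>_ _. 0)"
    unfolding mm_point_def fst_conv
    by (rule Metric_space.mspace_metric[OF Metric_space_unit],
        rule Metric_space.mdist_metric[OF Metric_space_unit])
  interpret prob_space "snd X" by (rule mm_space_prob[OF X])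
  have "distr (snd X) (count_space UNIV) (\<lambda>_. ()) = return (count_space UNIV) ()"
    by (rule distr_const) simp
  then have "distr (snd X) (snd mm_point) (\<lambda>_. ()) = snd mm_point"
    unfolding mm_point_def snd_conv by (metis distr_cong sets_return)
  then show ?thesis
    unfolding mm_iso_def m x by (intro exI[of _ "\<lambda>_. ()"]) (auto simp: x)
qed

theorem proposition4p5:
  fixes \<X> :: MM
  assumes "infinitely_divisible \<X>"
  shows "\<X> = \<E>"
proof -
  obtain x where "mspace (fst (representative \<X>)) = {x}"
    using mean_defect_zero_imp_singleton[OF representative(1)
        infinitely_divisible_mean_defect_le_0[OF assms]] by blast
  then have "mm_iso (representative \<X>) mm_point"
    by (rule singleton_iso_point[OF representative(1)])
  then have "class_of (representative \<X>) = class_of mm_point"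
    using class_of_eq_iff[OF representative(1) mm_space_point] by simp
  then show ?thesis by (simp add: representative(2) trivial_MM_def)
qed

end
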